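(* Let $(\mathfrak{A},\mathfrak{A}_0)$ be a quasi *-algebra with unit $\mathsf{e}$, let $\rho$ be a faithful normal semifinite trace on a von Neumann algebra, and let $\Phi:\mathfrak{A}\times\mathfrak{A}\to L^2(\rho)$ be a positive sesquilinear map satisfying the invariance condition $$\Phi(ax,y)=\Phi(x,a^*y),\qquad\forall a\in\mathfrak{A},\ x,y\in\mathfrak{A}_0.$$ Let $a,b$ be symmetric elements of $\mathfrak{A}$ (i.e. $a=a^*$, $b=b^*$) and assume that they admit a $\Phi$-commutator $c\in\mathfrak{A}$. Then, for every $\lambda,\mu\in\mathbb{R}$, $$(\Delta a)_\Phi(\lambda)\,(\Delta b)_\Phi(\mu)\ge\tfrac12\,\gamma_\Phi(c),$$ where $\gamma_\Phi(c)=\|\Phi(c,\mathsf{e})\|_2$.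
   Context: A quasi *-algebra $(\mathfrak{A},\mathfrak{A}_0)$ is a pair consisting of a vector space $\mathfrak{A}$ and a *-algebra $\mathfrak{A}_0$ contained in $\mathfrak{A}$ as a subspace such that: $\mathfrak{A}$ carries an involution $a\mapsto a^*$ extending that of $\mathfrak{A}_0$; $\mathfrak{A}$ is a bimodule over $\mathfrak{A}_0$ whose module multiplications extend the multiplication of $\mathfrak{A}_0$, in particular $(ca)d=c(ad)$ and $a(cd)=(ac)d$ for $a\in\mathfrak{A}$, $c,d\in\mathfrak{A}_0$; and $(ac)^*=c^*a^*$ for $a\in\mathfrak{A}$, $c\in\mathfrak{A}_0$. A unit is an element $\mathsf{e}\in\mathfrak{A}_0$ with $a\mathsf{e}=a=\mathsf{e}a$ for all $a\in\mathfrak{A}$. Elements $a,b\in\mathfrak{A}$ admit a $\Phi$-commutator $c\in\mathfrak{A}$ if $$\Phi(ax,b^*y)-\Phi(bx,a^*y)=\Phi(cx,y),\qquad\forall x,y\in\mathfrak{A}_0.$$ For $a\in\mathfrak{A}$ and $\lambda\in\mathbb{R}$, $(\Delta a)_\Phi(\lambda)=\|\Phi(a-\lambda\mathsf{e},a-\lambda\mathsf{e})\|_2^{1/2}$. $L^2(\rho)$ is the noncommutative $L^2$-space of the von Neumann algebra with trace $\rho$, with norm $\|X\|_2=\rho(|X|^2)^{1/2}$, $|X|=(X^*X)^{1/2}$. Sesquilinear means linear in the first variable and conjugate-linear in the second; $\Phi$ is positive if $\Phi(a,a)\ge0$ in $L^2(\rho)$ for every $a\in\mathfrak{A}$. *)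

theory Defs
  imports "HOL-Analysis.Analysis"
begin

section \<open>Complex vector spaces and Hilbert spaces\<close>

class scaleC = scaleR +
  fixes scaleC :: "complex \<Rightarrow> 'a \<Rightarrow> 'a" (infixr "*\<^sub>C" 75)
  assumes scaleR_scaleC: "r *\<^sub>R x = complex_of_real r *\<^sub>C x"

class complex_vector = scaleC + ab_group_add +
  assumes scaleC_add_right: "k *\<^sub>C (x + y) = k *\<^sub>C x + k *\<^sub>C y"
    and scaleC_add_left: "(k + l) *\<^sub>C x = k *\<^sub>C x + l *\<^sub>C x"
    and scaleC_scaleC: "k *\<^sub>C l *\<^sub>C x = (k * l) *\<^sub>C x"
    and scaleC_one: "1 *\<^sub>C x = x"

subclass (in complex_vector) real_vector
  by standard
    (simp_all add: scaleR_scaleC scaleC_add_right scaleC_add_left scaleC_scaleC scaleC_one)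

class complex_normed_vector = complex_vector + real_normed_vector +
  assumes norm_scaleC: "norm (k *\<^sub>C x) = cmod k * norm x"

class cbanach = complex_normed_vector + complete_space

text \<open>The complex inner product is linear in its first argument.  The class extends
  \<^class>\<open>real_inner\<close>, whose inner product is required to be the real part of the complex one;
  positivity and \<open>\<parallel>x\<parallel>\<^sup>2 = \<langle>x, x\<rangle>\<close> are inherited from there.\<close>

class complex_inner = complex_normed_vector + real_inner +
  fixes cinner :: "'a \<Rightarrow> 'a \<Rightarrow> complex"
  assumes cinner_commute: "cinner x y = cnj (cinner y x)"
    and cinner_add_left: "cinner (x + y) z = cinner x z + cinner y z"
    and cinner_scaleC_left: "cinner (k *\<^sub>C x) y = k * cinner x y"
    and inner_eq_Re_cinner: "inner x y = Re (cinner x y)"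

class chilbert_space = complex_inner + complete_space

instantiation complex :: chilbert_space
begin

definition scaleC_complex :: "complex \<Rightarrow> complex \<Rightarrow> complex"
  where "scaleC_complex k x = k * x"

definition cinner_complex :: "complex \<Rightarrow> complex \<Rightarrow> complex"
  where "cinner_complex x y = x * cnj y"

instance
  by standard
    (simp_all add: scaleC_complex_def cinner_complex_def scaleR_conv_of_real norm_mult
      inner_complex_def algebra_simps)

end

instance complex :: cbanach ..

lemma bounded_linear_scaleC:
  "bounded_linear (\<lambda>x::'a::complex_normed_vector. k *\<^sub>C x)"
proof (rule bounded_linear_intro[where K = "cmod k"])
  fix r and x y :: 'a
  show "k *\<^sub>C (x + y) = k *\<^sub>C x + k *\<^sub>C y"
    by (rule scaleC_add_right)
  show "k *\<^sub>C r *\<^sub>R x = r *\<^sub>R k *\<^sub>C x"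
    by (simp add: scaleR_scaleC scaleC_scaleC mult.commute)
  show "norm (k *\<^sub>C x) \<le> norm x * cmod k"
    by (simp add: norm_scaleC mult.commute)
qed

instantiation blinfun :: (real_normed_vector, complex_normed_vector) complex_vector
begin

definition scaleC_blinfun :: "complex \<Rightarrow> ('a, 'b) blinfun \<Rightarrow> ('a, 'b) blinfun"
  where "scaleC_blinfun k T = Blinfun (\<lambda>x. k *\<^sub>C blinfun_apply T x)"

lemma blinfun_apply_scaleC:
  fixes T :: "('a, 'b) blinfun"
  shows "blinfun_apply (k *\<^sub>C T) x = k *\<^sub>C blinfun_apply T x"
proof -
  have "bounded_linear (\<lambda>x. k *\<^sub>C blinfun_apply T x)"
    by (rule bounded_linear_compose[OF bounded_linear_scaleC blinfun.bounded_linear_right])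
  then show ?thesis
    by (simp add: scaleC_blinfun_def bounded_linear_Blinfun_apply)
qed

instance
  by standard
    (rule blinfun_eqI, simp add: blinfun_apply_scaleC blinfun.bilinear_simps
      scaleR_scaleC scaleC_add_right scaleC_add_left scaleC_scaleC scaleC_one)+

end

section \<open>Operators and von Neumann algebras\<close>

text \<open>The type \<open>'h \<Rightarrow>\<^sub>L 'h\<close> consists of the bounded real-linear operators;
  \<open>bounded_ops\<close> is the algebra of bounded complex-linear ones.\<close>

definition bounded_ops :: "('h::chilbert_space \<Rightarrow>\<^sub>L 'h) set"
  where "bounded_ops = {T. \<forall>k x. blinfun_apply T (k *\<^sub>C x) = k *\<^sub>C blinfun_apply T x}"

definition op_adj :: "('h::chilbert_space \<Rightarrow>\<^sub>L 'h) \<Rightarrow> ('h \<Rightarrow>\<^sub>L 'h)"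
  where "op_adj T =
    (THE S. \<forall>x y. cinner (blinfun_apply T x) y = cinner x (blinfun_apply S y))"

definition op_positive :: "('h::chilbert_space \<Rightarrow>\<^sub>L 'h) \<Rightarrow> bool"
  where "op_positive T \<longleftrightarrow> T \<in> bounded_ops \<and>
    (\<forall>x. Im (cinner (blinfun_apply T x) x) = 0 \<and> 0 \<le> Re (cinner (blinfun_apply T x) x))"

definition op_le :: "('h::chilbert_space \<Rightarrow>\<^sub>L 'h) \<Rightarrow> ('h \<Rightarrow>\<^sub>L 'h) \<Rightarrow> bool"
  where "op_le S T \<longleftrightarrow> op_positive (T - S)"

definition op_sqrt :: "('h::chilbert_space \<Rightarrow>\<^sub>L 'h) \<Rightarrow> ('h \<Rightarrow>\<^sub>L 'h)"
  where "op_sqrt T = (THE S. op_positive S \<and> S o\<^sub>L S = T)"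

definition op_abs :: "('h::chilbert_space \<Rightarrow>\<^sub>L 'h) \<Rightarrow> ('h \<Rightarrow>\<^sub>L 'h)"
  where "op_abs T = op_sqrt (op_adj T o\<^sub>L T)"

definition commutant :: "('h::chilbert_space \<Rightarrow>\<^sub>L 'h) set \<Rightarrow> ('h \<Rightarrow>\<^sub>L 'h) set"
  where "commutant S = {T \<in> bounded_ops. \<forall>X\<in>S. T o\<^sub>L X = X o\<^sub>L T}"

locale von_neumann_algebra =
  fixes M :: "('h::chilbert_space \<Rightarrow>\<^sub>L 'h) set"
  assumes bounded: "M \<subseteq> bounded_ops"
    and adj_closed: "T \<in> M \<Longrightarrow> op_adj T \<in> M"
    and bicommutant: "commutant (commutant M) = M"

definition pos_part :: "('h::chilbert_space \<Rightarrow>\<^sub>L 'h) set \<Rightarrow> ('h \<Rightarrow>\<^sub>L 'h) set"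
  where "pos_part M = {T \<in> M. op_positive T}"

text \<open>Only the values of \<open>\<rho>\<close> on the positive part of \<open>M\<close> are meaningful.  Normality is stated
  for upward directed subsets, which is the same as for increasing nets.\<close>

locale faithful_normal_semifinite_trace = von_neumann_algebra M
  for M :: "('h::chilbert_space \<Rightarrow>\<^sub>L 'h) set" +
  fixes \<rho> :: "('h \<Rightarrow>\<^sub>L 'h) \<Rightarrow> ennreal"
  assumes additive: "\<lbrakk>S \<in> pos_part M; T \<in> pos_part M\<rbrakk> \<Longrightarrow> \<rho> (S + T) = \<rho> S + \<rho> T"
    and pos_homogeneous:
      "\<lbrakk>0 \<le> r; T \<in> pos_part M\<rbrakk> \<Longrightarrow> \<rho> (r *\<^sub>R T) = ennreal r * \<rho> T"
    and tracial: "T \<in> M \<Longrightarrow> \<rho> (op_adj T o\<^sub>L T) = \<rho> (T o\<^sub>L op_adj T)"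
    and faithful: "\<lbrakk>T \<in> pos_part M; \<rho> T = 0\<rbrakk> \<Longrightarrow> T = 0"
    and normal: "\<lbrakk>D \<subseteq> pos_part M; D \<noteq> {};
        \<And>S S'. \<lbrakk>S \<in> D; S' \<in> D\<rbrakk> \<Longrightarrow> \<exists>S''\<in>D. op_le S S'' \<and> op_le S' S'';
        T \<in> pos_part M; \<And>S. S \<in> D \<Longrightarrow> op_le S T;
        \<And>U. \<lbrakk>U \<in> pos_part M; \<And>S. S \<in> D \<Longrightarrow> op_le S U\<rbrakk> \<Longrightarrow> op_le T U\<rbrakk>
      \<Longrightarrow> \<rho> T = (SUP S\<in>D. \<rho> S)"
    and semifinite: "\<lbrakk>T \<in> pos_part M; T \<noteq> 0\<rbrakk>
      \<Longrightarrow> \<exists>S\<in>pos_part M. S \<noteq> 0 \<and> op_le S T \<and> \<rho> S < \<infinity>"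

section \<open>The noncommutative \<open>L\<^sup>2\<close>-space\<close>

definition L2_ideal ::
    "('h::chilbert_space \<Rightarrow>\<^sub>L 'h) set \<Rightarrow> (('h \<Rightarrow>\<^sub>L 'h) \<Rightarrow> ennreal) \<Rightarrow> ('h \<Rightarrow>\<^sub>L 'h) set"
  where "L2_ideal M \<rho> = {X \<in> M. \<rho> (op_abs X o\<^sub>L op_abs X) < \<infinity>}"

definition L2_norm :: "(('h::chilbert_space \<Rightarrow>\<^sub>L 'h) \<Rightarrow> ennreal) \<Rightarrow> ('h \<Rightarrow>\<^sub>L 'h) \<Rightarrow> real"
  where "L2_norm \<rho> X = sqrt (enn2real (\<rho> (op_abs X o\<^sub>L op_abs X)))"

text \<open>\<open>L\<^sup>2(\<rho>)\<close> is the Banach space completion of \<open>{X \<in> M. \<rho>(|X|\<^sup>2) < \<infinity>}\<close> in the norm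
  \<open>\<rho>(|X|\<^sup>2)\<^sup>1\<^sup>/\<^sup>2\<close>: a complex Banach space \<open>'l\<close> with a linear isometric embedding \<open>\<iota>\<close> of dense
  range, unique up to isometric isomorphism.  Thus \<open>norm\<close> on \<open>'l\<close> is \<open>\<parallel>\<cdot>\<parallel>\<^sub>2\<close>.\<close>

locale noncommutative_L2 = faithful_normal_semifinite_trace M \<rho>
  for M :: "('h::chilbert_space \<Rightarrow>\<^sub>L 'h) set" and \<rho> :: "('h \<Rightarrow>\<^sub>L 'h) \<Rightarrow> ennreal" +
  fixes \<iota> :: "('h \<Rightarrow>\<^sub>L 'h) \<Rightarrow> 'l::cbanach"
  assumes embed_add:
      "\<lbrakk>X \<in> L2_ideal M \<rho>; Y \<in> L2_ideal M \<rho>\<rbrakk> \<Longrightarrow> \<iota> (X + Y) = \<iota> X + \<iota> Y"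
    and embed_scaleC: "X \<in> L2_ideal M \<rho> \<Longrightarrow> \<iota> (k *\<^sub>C X) = k *\<^sub>C \<iota> X"
    and embed_norm: "X \<in> L2_ideal M \<rho> \<Longrightarrow> norm (\<iota> X) = L2_norm \<rho> X"
    and embed_dense: "closure (\<iota> ` L2_ideal M \<rho>) = UNIV"

text \<open>The positive elements of \<open>L\<^sup>2(\<rho>)\<close> are the \<open>\<parallel>\<cdot>\<parallel>\<^sub>2\<close>-limits of positive operators.\<close>

definition L2_positive ::
    "('h::chilbert_space \<Rightarrow>\<^sub>L 'h) set \<Rightarrow> (('h \<Rightarrow>\<^sub>L 'h) \<Rightarrow> ennreal) \<Rightarrow> (('h \<Rightarrow>\<^sub>L 'h) \<Rightarrow> 'l::cbanach)
      \<Rightarrow> 'l \<Rightarrow> bool"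
  where "L2_positive M \<rho> \<iota> Z \<longleftrightarrow> Z \<in> closure (\<iota> ` {X \<in> L2_ideal M \<rho>. op_positive X})"

section \<open>Quasi *-algebras\<close>

text \<open>\<open>\<AA>\<close> is the whole type \<open>'a\<close>, and \<open>A0\<close> is \<open>\<AA>\<^sub>0\<close>.  The one function \<open>mul\<close> gives the product
  of \<open>\<AA>\<^sub>0\<close> and both module multiplications, so that the latter extend the former; its values are
  unconstrained when neither argument lies in \<open>A0\<close>.\<close>

locale quasi_star_algebra =
  fixes A0 :: "'a::complex_vector set"
    and mul :: "'a \<Rightarrow> 'a \<Rightarrow> 'a"
    and star :: "'a \<Rightarrow> 'a"
  assumes zero_mem: "0 \<in> A0"
    and add_mem: "\<lbrakk>x \<in> A0; y \<in> A0\<rbrakk> \<Longrightarrow> x + y \<in> A0"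
    and scaleC_mem: "x \<in> A0 \<Longrightarrow> k *\<^sub>C x \<in> A0"
    and mult_mem: "\<lbrakk>x \<in> A0; y \<in> A0\<rbrakk> \<Longrightarrow> mul x y \<in> A0"
    and star_mem: "x \<in> A0 \<Longrightarrow> star x \<in> A0"
    and star_star: "star (star a) = a"
    and star_add: "star (a + b) = star a + star b"
    and star_scaleC: "star (k *\<^sub>C a) = cnj k *\<^sub>C star a"
    and rmult_add_left: "x \<in> A0 \<Longrightarrow> mul (a + b) x = mul a x + mul b x"
    and rmult_add_right: "\<lbrakk>x \<in> A0; y \<in> A0\<rbrakk> \<Longrightarrow> mul a (x + y) = mul a x + mul a y"
    and rmult_scaleC_left: "x \<in> A0 \<Longrightarrow> mul (k *\<^sub>C a) x = k *\<^sub>C mul a x"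
    and rmult_scaleC_right: "x \<in> A0 \<Longrightarrow> mul a (k *\<^sub>C x) = k *\<^sub>C mul a x"
    and lmult_add_left: "\<lbrakk>x \<in> A0; y \<in> A0\<rbrakk> \<Longrightarrow> mul (x + y) a = mul x a + mul y a"
    and lmult_add_right: "x \<in> A0 \<Longrightarrow> mul x (a + b) = mul x a + mul x b"
    and lmult_scaleC_left: "x \<in> A0 \<Longrightarrow> mul (k *\<^sub>C x) a = k *\<^sub>C mul x a"
    and lmult_scaleC_right: "x \<in> A0 \<Longrightarrow> mul x (k *\<^sub>C a) = k *\<^sub>C mul x a"
    and bimodule_assoc:
      "\<lbrakk>x \<in> A0; y \<in> A0\<rbrakk> \<Longrightarrow> mul (mul x a) y = mul x (mul a y)"
    and rmult_assoc: "\<lbrakk>x \<in> A0; y \<in> A0\<rbrakk> \<Longrightarrow> mul a (mul x y) = mul (mul a x) y"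
    and lmult_assoc: "\<lbrakk>x \<in> A0; y \<in> A0\<rbrakk> \<Longrightarrow> mul (mul x y) a = mul x (mul y a)"
    and star_mult: "x \<in> A0 \<Longrightarrow> star (mul a x) = mul (star x) (star a)"

locale unital_quasi_star_algebra = quasi_star_algebra A0 mul star
  for A0 :: "'a::complex_vector set" and mul :: "'a \<Rightarrow> 'a \<Rightarrow> 'a" and star :: "'a \<Rightarrow> 'a" +
  fixes e :: 'a
  assumes unit_mem: "e \<in> A0"
    and mult_unit_right: "mul a e = a"
    and mult_unit_left: "mul e a = a"

section \<open>Sesquilinear maps\<close>

definition sesquilinear :: "('a::complex_vector \<Rightarrow> 'a \<Rightarrow> 'l::complex_vector) \<Rightarrow> bool"
  where "sesquilinear \<Phi> \<longleftrightarrow>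
    (\<forall>a b d. \<Phi> (a + b) d = \<Phi> a d + \<Phi> b d) \<and>
    (\<forall>k a d. \<Phi> (k *\<^sub>C a) d = k *\<^sub>C \<Phi> a d) \<and>
    (\<forall>a b d. \<Phi> a (b + d) = \<Phi> a b + \<Phi> a d) \<and>
    (\<forall>k a d. \<Phi> a (k *\<^sub>C d) = cnj k *\<^sub>C \<Phi> a d)"

definition invariant_map ::
    "'a set \<Rightarrow> ('a \<Rightarrow> 'a \<Rightarrow> 'a) \<Rightarrow> ('a \<Rightarrow> 'a) \<Rightarrow> ('a \<Rightarrow> 'a \<Rightarrow> 'l) \<Rightarrow> bool"
  where "invariant_map A0 mul star \<Phi> \<longleftrightarrow>
    (\<forall>a. \<forall>x\<in>A0. \<forall>y\<in>A0. \<Phi> (mul a x) y = \<Phi> x (mul (star a) y))"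

definition is_commutator ::
    "'a set \<Rightarrow> ('a \<Rightarrow> 'a \<Rightarrow> 'a) \<Rightarrow> ('a \<Rightarrow> 'a) \<Rightarrow> ('a \<Rightarrow> 'a \<Rightarrow> 'l::minus) \<Rightarrow> 'a \<Rightarrow> 'a \<Rightarrow> 'a \<Rightarrow> bool"
  where "is_commutator A0 mul star \<Phi> a b c \<longleftrightarrow>
    (\<forall>x\<in>A0. \<forall>y\<in>A0.
      \<Phi> (mul a x) (mul (star b) y) - \<Phi> (mul b x) (mul (star a) y) = \<Phi> (mul c x) y)"

definition uncertainty ::
    "('a::complex_vector \<Rightarrow> 'a \<Rightarrow> 'l::cbanach) \<Rightarrow> 'a \<Rightarrow> 'a \<Rightarrow> real \<Rightarrow> real"
  where "uncertainty \<Phi> e a r =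
    sqrt (norm (\<Phi> (a - complex_of_real r *\<^sub>C e) (a - complex_of_real r *\<^sub>C e)))"

definition gamma_map :: "('a \<Rightarrow> 'a \<Rightarrow> 'l::cbanach) \<Rightarrow> 'a \<Rightarrow> 'a \<Rightarrow> real"
  where "gamma_map \<Phi> e c = norm (\<Phi> c e)"

end

theory Submission
  imports Defs
begin

text \<open>Replacing \<open>a\<close> and \<open>b\<close> by \<open>a - re\<close> and \<open>b - se\<close> leaves \<open>\<Phi>(a, b) - \<Phi>(b, a)\<close> unchanged,
  because invariance gives \<open>\<Phi>(a, e) = \<Phi>(e, a)\<close> for symmetric \<open>a\<close>; and evaluating the commutator
  identity at the unit shows that this difference is \<open>C = \<Phi>(c, e)\<close>.  So everything reduces to
  \<open>\<parallel>\<Phi>(a, b) - \<Phi>(b, a)\<parallel> \<le> 2 \<parallel>\<Phi>(a, a)\<parallel>\<^sup>1\<^sup>/\<^sup>2 \<parallel>\<Phi>(b, b)\<parallel>\<^sup>1\<^sup>/\<^sup>2\<close> for arbitrary \<open>a\<close>, \<open>b\<close>.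

  This cannot be deduced from a Cauchy-Schwarz inequality
  \<open>\<parallel>\<Phi>(a, b)\<parallel>\<^sup>2 \<le> \<parallel>\<Phi>(a, a)\<parallel> \<parallel>\<Phi>(b, b)\<parallel>\<close>, which is false for \<open>L\<^sup>2(\<rho>)\<close>-valued positive maps: on two-by-two
  matrices \<open>\<Phi>(a, a) = \<Phi>(b, b) = 1\<close> and \<open>\<Phi>(a, b) = 2 E\<^sub>1\<^sub>2\<close> is possible.  What positivity does control
  is the skew part of \<open>\<Phi>(a, b)\<close>.  Put \<open>A = \<Phi>(a, a)\<close> and \<open>B = \<Phi>(b, b)\<close>.  For real \<open>t\<close>, evaluating
  \<open>\<Phi>\<close> on the diagonal at \<open>ta + \<i>b\<close> and \<open>ta - \<i>b\<close> shows that \<open>t\<^sup>2A + B - \<i>tC\<close> and \<open>t\<^sup>2A + B + \<i>tC\<close> are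
  positive.  Since \<open>\<parallel>P - R\<parallel> \<le> \<parallel>P + R\<parallel>\<close> for positive \<open>P\<close>, \<open>R\<close> in \<open>L\<^sup>2(\<rho>)\<close>
  (\<open>L2_positive_norm_diff_le_add\<close>), we get \<open>t \<parallel>C\<parallel> \<le> t\<^sup>2 \<parallel>A\<parallel> + \<parallel>B\<parallel>\<close> for all \<open>t > 0\<close>, and the best \<open>t\<close>
  gives the claim.

  The inequality \<open>\<parallel>P - R\<parallel> \<le> \<parallel>P + R\<parallel>\<close> expresses that \<open>\<rho>(XY) \<ge> 0\<close> for positive \<open>X\<close>, \<open>Y\<close>.  Formally
  \<open>\<rho>(XY) = \<rho>(Y\<^sup>1\<^sup>/\<^sup>2 X Y\<^sup>1\<^sup>/\<^sup>2)\<close>, but \<open>\<rho>\<close> is only given on positive operators and \<open>\<rho>(Y)\<close> may be infinite.  If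
  \<open>Y = Q\<^sup>2\<close> with \<open>\<rho>(Q\<^sup>2) < \<infinity>\<close>, one application of \<open>\<rho>(T\<^sup>*T) = \<rho>(TT\<^sup>*)\<close> to \<open>T = Q + XQ\<close> produces the
  inequality with all terms that have to be cancelled finite (\<open>trace_square_diff_le_add\<close>).  Normality
  of \<open>\<rho>\<close> shows that such squares are dense among the positive elements of \<open>L\<^sup>2(\<rho>)\<close>
  (\<open>square_approximation\<close>).  This density, as well as the identity \<open>|X|\<^sup>2 = X\<^sup>2\<close> for hermitian \<open>X\<close>
  that makes the norm computable, rests on existence and uniqueness of positive square roots
  (\<open>op_sqrt_properties\<close>).\<close>

section \<open>Hermitian and positive operators\<close>

text \<open>Completeness of the operator type, in which square roots are constructed as limits, requires
  the underlying space to be of class \<^class>\<open>banach\<close>.\<close>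

instance chilbert_space \<subseteq> banach ..

lemma scaleC_minus_one: "(-1) *\<^sub>C (x :: 'a::complex_vector) = - x"
  using scaleR_scaleC[of "-1" x] by simp

lemma scaleC_minus_left: "(- k) *\<^sub>C (x :: 'a::complex_vector) = - (k *\<^sub>C x)"
  using scaleC_scaleC[of "-1" k x] by (simp add: scaleC_minus_one)

lemma scaleC_diff_right: "k *\<^sub>C (x - y :: 'a::complex_vector) = k *\<^sub>C x - k *\<^sub>C y"
  using scaleC_add_right[of k "x - y" y] by simp

text \<open>The complex inner product is recovered from its real part, so for complex-linear operators all
  statements about adjoints and positivity can be reduced to the real inner product.\<close>

lemma cinner_eq_inner:
  "cinner x y = Complex (inner x y) (- inner (\<i> *\<^sub>C x) y)" for x y :: "'h::chilbert_space"
  by (simp add: complex_eq_iff inner_eq_Re_cinner cinner_scaleC_left)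

lemma bounded_ops_scaleC: "T \<in> bounded_ops \<Longrightarrow> T (k *\<^sub>C x) = k *\<^sub>C T x"
  by (simp add: bounded_ops_def)

definition hermitian :: "('h::chilbert_space \<Rightarrow>\<^sub>L 'h) \<Rightarrow> bool"
  where "hermitian T \<longleftrightarrow> T \<in> bounded_ops \<and> (\<forall>x y. inner (T x) y = inner x (T y))"

lemma op_adj_eqI:
  fixes S T :: "'h::chilbert_space \<Rightarrow>\<^sub>L 'h"
  assumes "S \<in> bounded_ops" "T \<in> bounded_ops" and adj: "\<And>x y. inner (T x) y = inner x (S y)"
  shows "op_adj T = S"
  unfolding op_adj_def
proof (rule the_equality)
  show *: "\<forall>x y. cinner (T x) y = cinner x (S y)"
    using assms by (simp add: cinner_eq_inner flip: bounded_ops_scaleC)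
  fix R assume R: "\<forall>x y. cinner (T x) y = cinner x (blinfun_apply R y)"
  show "R = S"
  proof (rule blinfun_eqI)
    fix y
    have "inner x (R y) = inner x (S y)" for x
      using R * by (simp add: inner_eq_Re_cinner)
    then show "R y = S y"
      by (metis inner_commute vector_eq_ldot)
  qed
qed

lemma op_adj_hermitian: "hermitian T \<Longrightarrow> op_adj T = T"
  by (rule op_adj_eqI) (auto simp: hermitian_def)

text \<open>A real-valued quadratic form forces symmetry by polarization: \<open>\<langle>\<i>Tx, y\<rangle>\<close> is skew in \<open>x\<close>, \<open>y\<close>, and
  replacing \<open>y\<close> by \<open>\<i>y\<close> turns this into \<open>\<langle>Tx, y\<rangle> = \<langle>x, Ty\<rangle>\<close>.\<close>

lemma op_positive_iff:
  "op_positive T \<longleftrightarrow> hermitian T \<and> (\<forall>x. 0 \<le> inner (T x) x)"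
proof
  assume T: "op_positive T"
  then have b: "T \<in> bounded_ops" and im: "\<And>x. inner (\<i> *\<^sub>C T x) x = 0"
    and re: "\<And>x. 0 \<le> inner (T x) x"
    by (auto simp: op_positive_def cinner_eq_inner)
  have sym: "inner (\<i> *\<^sub>C T x) y = - inner (\<i> *\<^sub>C T y) x" for x y
    using im[of "x + y"] im[of x] im[of y]
    by (simp add: blinfun.bilinear_simps scaleC_add_right inner_add_left inner_add_right)
  have i: "inner (\<i> *\<^sub>C u) (\<i> *\<^sub>C v) = inner u v" for u v :: 'a
    by (simp add: inner_eq_Re_cinner cinner_scaleC_left, subst (1 2) cinner_commute)
      (simp add: cinner_scaleC_left)
  have "inner (T x) y = inner x (T y)" for x y
  proof -
    have "inner (T x) y = inner (\<i> *\<^sub>C T x) (\<i> *\<^sub>C y)" by (simp add: i)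
    also have "\<dots> = - inner (\<i> *\<^sub>C T (\<i> *\<^sub>C y)) x" by (rule sym)
    also have "\<dots> = inner (T y) x"
      by (simp add: bounded_ops_scaleC[OF b] scaleC_scaleC scaleC_minus_one)
    finally show ?thesis by (simp add: inner_commute)
  qed
  then show "hermitian T \<and> (\<forall>x. 0 \<le> inner (T x) x)"
    using b re by (simp add: hermitian_def)
next
  assume T: "hermitian T \<and> (\<forall>x. 0 \<le> inner (T x) x)"
  have "cinner (T x) x = cnj (cinner (T x) x)" for x
    using T cinner_commute[of "T x" x]
    by (simp add: cinner_eq_inner hermitian_def flip: bounded_ops_scaleC)
  then have "Im (cinner (T x) x) = 0" for x
    by (metis Reals_cnj_iff complex_is_Real_iff)
  then show "op_positive T"
    using T by (auto simp: op_positive_def hermitian_def inner_eq_Re_cinner)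
qed

lemma op_positiveI:
  "hermitian T \<Longrightarrow> (\<And>x. 0 \<le> inner (T x) x) \<Longrightarrow> op_positive T"
  by (simp add: op_positive_iff)

lemma op_positive_hermitian: "op_positive T \<Longrightarrow> hermitian T"
  and op_positive_inner: "op_positive T \<Longrightarrow> 0 \<le> inner (T x) x"
  by (auto simp: op_positive_iff)

lemma hermitian_bounded: "hermitian T \<Longrightarrow> T \<in> bounded_ops"
  and hermitian_inner: "hermitian T \<Longrightarrow> inner (T x) y = inner x (T y)"
  by (auto simp: hermitian_def)

lemma bounded_ops_id: "id_blinfun \<in> bounded_ops"
  and bounded_ops_add: "\<lbrakk>S \<in> bounded_ops; T \<in> bounded_ops\<rbrakk> \<Longrightarrow> S + T \<in> bounded_ops"
  and bounded_ops_scaleR: "T \<in> bounded_ops \<Longrightarrow> r *\<^sub>R T \<in> bounded_ops"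
  and bounded_ops_compose: "\<lbrakk>S \<in> bounded_ops; T \<in> bounded_ops\<rbrakk> \<Longrightarrow> S o\<^sub>L T \<in> bounded_ops"
  for S T :: "'h::chilbert_space \<Rightarrow>\<^sub>L 'h"
  by (auto simp: bounded_ops_def blinfun.bilinear_simps scaleC_add_right
      scaleR_scaleC[where 'a = 'h] scaleC_scaleC mult.commute)

lemma blinfun_commute_iff: "R o\<^sub>L T = T o\<^sub>L R \<longleftrightarrow> (\<forall>x. R (T x) = T (R x))"
  by (metis blinfun_apply_blinfun_compose blinfun_eqI)

lemma hermitian_id: "hermitian id_blinfun"
  by (simp add: hermitian_def bounded_ops_id)

lemma hermitian_add: "\<lbrakk>hermitian S; hermitian T\<rbrakk> \<Longrightarrow> hermitian (S + T)"
  by (simp add: hermitian_def bounded_ops_add blinfun.bilinear_simps inner_simps)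

lemma hermitian_scaleR: "hermitian T \<Longrightarrow> hermitian (r *\<^sub>R T)"
  by (simp add: hermitian_def bounded_ops_scaleR blinfun.bilinear_simps)

lemma hermitian_diff: "\<lbrakk>hermitian S; hermitian T\<rbrakk> \<Longrightarrow> hermitian (S - T)"
  using hermitian_add[OF _ hermitian_scaleR[of T "-1"]] by simp

lemma hermitian_compose:
  "\<lbrakk>hermitian S; hermitian T; S o\<^sub>L T = T o\<^sub>L S\<rbrakk> \<Longrightarrow> hermitian (S o\<^sub>L T)"
  by (simp add: hermitian_def bounded_ops_compose blinfun_commute_iff)

lemma hermitian_sandwich:
  "\<lbrakk>hermitian S; hermitian T\<rbrakk> \<Longrightarrow> hermitian (S o\<^sub>L T o\<^sub>L S)"
  by (simp add: hermitian_def bounded_ops_compose)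

lemma inner_square: "hermitian T \<Longrightarrow> inner (T (T x)) x = (norm (T x))\<^sup>2"
  by (simp add: hermitian_inner[of T "blinfun_apply T x" x] power2_norm_eq_inner)

lemma op_positive_square: "hermitian T \<Longrightarrow> op_positive (T o\<^sub>L T)"
  by (intro op_positiveI hermitian_compose) (simp_all add: inner_square)

lemma op_positive_compose_adjoint:
  assumes "S \<in> bounded_ops" "T \<in> bounded_ops" "\<And>x y. inner (T x) y = inner x (S y)"
  shows "op_positive (T o\<^sub>L S)"
  by (rule op_positiveI)
    (simp_all add: hermitian_def bounded_ops_compose assms inner_commute[of _ "blinfun_apply T _"],
      simp add: inner_commute)

lemma op_positive_sandwich:
  "\<lbrakk>hermitian S; op_positive T\<rbrakk> \<Longrightarrow> op_positive (S o\<^sub>L T o\<^sub>L S)"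
  by (intro op_positiveI hermitian_sandwich)
    (simp_all add: op_positive_hermitian hermitian_inner[of S] op_positive_inner)

lemma op_positive_add: "\<lbrakk>op_positive S; op_positive T\<rbrakk> \<Longrightarrow> op_positive (S + T)"
  by (simp add: op_positive_iff hermitian_add blinfun.bilinear_simps inner_simps)

lemma op_positive_scaleR: "\<lbrakk>0 \<le> r; op_positive T\<rbrakk> \<Longrightarrow> op_positive (r *\<^sub>R T)"
  by (simp add: op_positive_iff hermitian_scaleR blinfun.bilinear_simps)

lemma op_leI:
  "\<lbrakk>hermitian S; hermitian T; \<And>x. inner (S x) x \<le> inner (T x) x\<rbrakk> \<Longrightarrow> op_le S T"
  by (simp add: op_le_def op_positive_iff hermitian_diff blinfun.bilinear_simps inner_simps)

lemma op_le_inner: "op_le S T \<Longrightarrow> inner (S x) x \<le> inner (T x) x"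
  by (simp add: op_le_def op_positive_iff blinfun.bilinear_simps inner_simps)

lemma inner_le_norm_square: "inner (T x) x \<le> norm T * (norm x)\<^sup>2"
  for T :: "'h::chilbert_space \<Rightarrow>\<^sub>L 'h"
proof -
  have "inner (T x) x \<le> norm (T x) * norm x"
    by (rule norm_cauchy_schwarz)
  also have "\<dots> \<le> norm T * norm x * norm x"
    by (intro mult_right_mono norm_blinfun) simp
  finally show ?thesis by (simp add: power2_eq_square mult.assoc)
qed

lemma op_positive_id_minus:
  fixes T :: "'h::chilbert_space \<Rightarrow>\<^sub>L 'h"
  assumes "hermitian T" "norm T \<le> 1"
  shows "op_positive (id_blinfun - T)"
proof (rule op_positiveI)
  show "hermitian (id_blinfun - T)"
    using assms by (intro hermitian_diff hermitian_id)
  fix x :: 'h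
  have "norm T * (norm x)\<^sup>2 \<le> 1 * (norm x)\<^sup>2"
    using assms by (intro mult_right_mono) auto
  then show "0 \<le> inner ((id_blinfun - T) x) x"
    using inner_le_norm_square[of T x]
    by (simp add: blinfun.bilinear_simps inner_simps power2_norm_eq_inner)
qed

text \<open>The operator inequality \<open>T\<^sup>2 \<le> T\<close> for \<open>0 \<le> T \<le> 1\<close>; it follows from
  \<open>T - T\<^sup>2 = T(1 - T)T + (1 - T)T(1 - T)\<close>.\<close>

lemma norm_square_le_inner:
  assumes "op_positive T" "norm T \<le> 1"
  shows "(norm (T x))\<^sup>2 \<le> inner (T x) x"
proof -
  have sym: "inner (T x) y = inner x (T y)" for x y
    using assms by (simp add: op_positive_hermitian hermitian_inner)
  have "0 \<le> inner ((id_blinfun - T) (T x)) (T x)"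
    using assms by (intro op_positive_inner op_positive_id_minus op_positive_hermitian)
  moreover have "0 \<le> inner (T (x - T x)) (x - T x)"
    using assms by (intro op_positive_inner)
  ultimately show ?thesis
    by (simp add: blinfun.bilinear_simps inner_simps power2_norm_eq_inner sym)
qed

lemma norm_id_minus_square:
  assumes "op_positive T" "norm T \<le> 1"
  shows "(norm (T x))\<^sup>2 \<le> (norm x)\<^sup>2 - (norm (x - T x))\<^sup>2"
  using norm_square_le_inner[OF assms, of x]
  by (simp add: power2_norm_eq_inner inner_simps inner_commute)

lemma norm_id_minus_le_one:
  fixes T :: "'h::chilbert_space \<Rightarrow>\<^sub>L 'h"
  assumes "op_positive T" "norm T \<le> 1"
  shows "norm (id_blinfun - T) \<le> 1"
proof (rule norm_blinfun_bound)
  fix x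
  have "0 \<le> (norm (T x))\<^sup>2" by simp
  then have "(norm (x - T x))\<^sup>2 \<le> (norm x)\<^sup>2"
    using norm_id_minus_square[OF assms, of x] by linarith
  then show "norm ((id_blinfun - T) x) \<le> 1 * norm x"
    by (simp add: blinfun.bilinear_simps)
qed simp

section \<open>Square roots of positive operators\<close>

text \<open>If \<open>S\<close> is a fixed point of \<open>S = (U + S\<^sup>2)/2\<close>, then \<open>(1 - S)\<^sup>2 = 1 - U\<close>.  Thus a square root of \<open>T\<close>
  comes from iterating this map with \<open>U = 1 - T\<close>.\<close>

primrec sqrt_iter :: "('h::chilbert_space \<Rightarrow>\<^sub>L 'h) \<Rightarrow> nat \<Rightarrow> ('h \<Rightarrow>\<^sub>L 'h)"
  where "sqrt_iter U 0 = 0"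
  | "sqrt_iter U (Suc n) = (1/2) *\<^sub>R (U + (sqrt_iter U n o\<^sub>L sqrt_iter U n))"

text \<open>The iteration for the scalar \<open>U = 1\<close> dominates the one for every contraction \<open>U\<close>, both in the
  size of its terms and in the size of its increments; being increasing and bounded by \<open>1\<close>, it
  forces convergence of the operator iteration in norm.\<close>

primrec sqrt_majorant :: "nat \<Rightarrow> real"
  where "sqrt_majorant 0 = 0"
  | "sqrt_majorant (Suc n) = (1 + (sqrt_majorant n)\<^sup>2) / 2"

lemma sqrt_majorant_bounds: "0 \<le> sqrt_majorant n \<and> sqrt_majorant n \<le> 1"
  by (induction n) (auto simp: power_le_one)

lemma sqrt_majorant_Suc: "sqrt_majorant n \<le> sqrt_majorant (Suc n)"
proof -
  have "0 \<le> (1 - sqrt_majorant n)\<^sup>2" by simp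
  then show ?thesis by (simp add: power2_eq_square algebra_simps)
qed

lemma convergent_sqrt_majorant: "convergent sqrt_majorant"
  by (rule Bseq_monoseq_convergent)
    (auto intro!: BseqI'[of _ 1] incseq_imp_monoseq incseq_SucI sqrt_majorant_Suc
      simp: sqrt_majorant_bounds simp del: sqrt_majorant.simps)

lemma sqrt_iter_norm:
  assumes "norm U \<le> 1"
  shows "norm (sqrt_iter U n) \<le> sqrt_majorant n"
proof (induction n)
  case (Suc n)
  have "norm (sqrt_iter U n o\<^sub>L sqrt_iter U n) \<le> (sqrt_majorant n)\<^sup>2"
    using order_trans[OF norm_blinfun_compose mult_mono[OF Suc Suc]] sqrt_majorant_bounds[of n]
    by (simp add: power2_eq_square)
  then show ?case
    using norm_triangle_ineq[of U "sqrt_iter U n o\<^sub>L sqrt_iter U n"] assms by simp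
qed simp

lemma sqrt_iter_norm_diff:
  assumes "norm U \<le> 1"
  shows "norm (sqrt_iter U (Suc n) - sqrt_iter U n) \<le> sqrt_majorant (Suc n) - sqrt_majorant n"
proof (induction n)
  case 0
  then show ?case using assms by (simp add: blinfun.bilinear_simps)
next
  case (Suc n)
  define A where "A = sqrt_iter U n"
  define B where "B = sqrt_iter U (Suc n)"
  define s where "s = sqrt_majorant n"
  define t where "t = sqrt_majorant (Suc n)"
  have AB: "norm A \<le> s" "norm B \<le> t" "norm (B - A) \<le> t - s" and s: "0 \<le> s"
    using Suc sqrt_iter_norm[OF assms] sqrt_majorant_bounds
    unfolding A_def B_def s_def t_def by blast+
  \<comment> \<open>difference of squares as \<open>B\<^sup>2 - A\<^sup>2 = B(B - A) + (B - A)A\<close>\<close>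
  have "sqrt_iter U (Suc (Suc n)) - B = (1/2) *\<^sub>R ((B o\<^sub>L (B - A)) + ((B - A) o\<^sub>L A))"
    unfolding sqrt_iter.simps(2)[of U "Suc n"] B_def[symmetric]
    unfolding A_def B_def
    by (rule blinfun_eqI) (simp add: blinfun.bilinear_simps algebra_simps)
  also have "norm \<dots> \<le> (norm (B o\<^sub>L (B - A)) + norm ((B - A) o\<^sub>L A)) / 2"
    by (simp add: norm_triangle_ineq)
  also have "\<dots> \<le> (t * (t - s) + (t - s) * s) / 2"
    by (intro divide_right_mono add_mono order_trans[OF norm_blinfun_compose] mult_mono)
      (use AB s order_trans[OF norm_ge_zero AB(2)] order_trans[OF norm_ge_zero AB(3)] in auto)
  also have "\<dots> = sqrt_majorant (Suc (Suc n)) - t"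
    unfolding sqrt_majorant.simps(2)[of "Suc n"] t_def[symmetric]
    unfolding t_def s_def by (simp add: power2_eq_square field_simps)
  finally show ?case unfolding B_def t_def .
qed

lemma Cauchy_sqrt_iter:
  assumes "norm U \<le> 1"
  shows "Cauchy (sqrt_iter U)"
proof (rule metric_CauchyI)
  have le: "norm (sqrt_iter U (n + k) - sqrt_iter U n) \<le> sqrt_majorant (n + k) - sqrt_majorant n"
    for n k
  proof (induction k)
    case (Suc k)
    have "norm (sqrt_iter U (n + Suc k) - sqrt_iter U n)
      \<le> norm (sqrt_iter U (Suc (n + k)) - sqrt_iter U (n + k))
        + norm (sqrt_iter U (n + k) - sqrt_iter U n)"
      by (rule order_trans[OF _ norm_triangle_ineq]) simp
    with Suc sqrt_iter_norm_diff[OF assms, of "n + k"] show ?case by simp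
  qed simp
  fix \<epsilon> :: real assume "\<epsilon> > 0"
  then obtain N where N: "\<And>m n. m \<ge> N \<Longrightarrow> n \<ge> N \<Longrightarrow> dist (sqrt_majorant m) (sqrt_majorant n) < \<epsilon>"
    using convergent_Cauchy[OF convergent_sqrt_majorant] unfolding Cauchy_def by blast
  have "dist (sqrt_iter U m) (sqrt_iter U n) < \<epsilon>" if "n \<ge> N" "m \<ge> n" for m n
    using le[of n "m - n"] N[of m n] that by (simp add: dist_norm)
  then show "\<exists>N. \<forall>m\<ge>N. \<forall>n\<ge>N. dist (sqrt_iter U m) (sqrt_iter U n) < \<epsilon>"
    by (metis dist_commute nat_le_linear)
qed

lemma sqrt_iter_commute:
  "R o\<^sub>L U = U o\<^sub>L R \<Longrightarrow> R o\<^sub>L sqrt_iter U n = sqrt_iter U n o\<^sub>L R"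
  by (induction n)
    (auto simp: blinfun_commute_iff blinfun.bilinear_simps)

lemma sqrt_iter_hermitian: "hermitian U \<Longrightarrow> hermitian (sqrt_iter U n)"
proof (induction n)
  case 0
  show ?case using hermitian_scaleR[OF hermitian_id, of 0] by simp
qed (auto intro!: hermitian_scaleR hermitian_add hermitian_compose)

lemma hermitian_limit:
  assumes "\<And>n. hermitian (F n)" "F \<longlonglongrightarrow> T"
  shows "hermitian T"
proof -
  have lim: "(\<lambda>n. F n x) \<longlonglongrightarrow> T x" for x
    by (intro tendsto_intros assms)
  have "T (k *\<^sub>C x) = k *\<^sub>C T x" for k x
  proof (rule LIMSEQ_unique)
    show "(\<lambda>n. F n (k *\<^sub>C x)) \<longlonglongrightarrow> T (k *\<^sub>C x)" by (rule lim)
    show "(\<lambda>n. F n (k *\<^sub>C x)) \<longlonglongrightarrow> k *\<^sub>C T x"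
      using bounded_linear.tendsto[OF bounded_linear_scaleC lim]
      by (simp add: bounded_ops_scaleC hermitian_bounded assms)
  qed
  moreover have "inner (T x) y = inner x (T y)" for x y
  proof (rule LIMSEQ_unique)
    show "(\<lambda>n. inner (F n x) y) \<longlonglongrightarrow> inner (T x) y"
      by (intro tendsto_intros lim)
    show "(\<lambda>n. inner (F n x) y) \<longlonglongrightarrow> inner x (T y)"
      using tendsto_inner[OF tendsto_const lim] by (simp add: hermitian_inner assms)
  qed
  ultimately show ?thesis by (simp add: hermitian_def bounded_ops_def)
qed

text \<open>The limit of the iteration inherits from its terms that it is hermitian, has norm at most \<open>1\<close>
  and commutes with whatever commutes with \<open>T\<close>.  The last property yields uniqueness below, and
  membership of roots in a von Neumann algebra.\<close>

lemma exists_sqrt_contraction: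
  fixes T :: "'h::chilbert_space \<Rightarrow>\<^sub>L 'h"
  assumes "op_positive T" "norm T \<le> 1"
  shows "\<exists>S. op_positive S \<and> S o\<^sub>L S = T \<and> (\<forall>R. R o\<^sub>L T = T o\<^sub>L R \<longrightarrow> R o\<^sub>L S = S o\<^sub>L R)"
proof -
  define U where "U = id_blinfun - T"
  have U: "hermitian U" "norm U \<le> 1"
    using assms by (auto simp: U_def op_positive_hermitian hermitian_id norm_id_minus_le_one
      intro!: hermitian_diff)
  obtain S where S: "sqrt_iter U \<longlonglongrightarrow> S"
    using Cauchy_sqrt_iter[OF U(2)] Cauchy_convergent_iff convergent_def by blast
  have lim: "(\<lambda>n. sqrt_iter U n x) \<longlonglongrightarrow> S x" for x
    by (intro tendsto_intros S)
  have "(\<lambda>n. sqrt_iter U (Suc n)) \<longlonglongrightarrow> (1/2) *\<^sub>R (U + (S o\<^sub>L S))"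
    unfolding sqrt_iter.simps
    by (intro tendsto_intros bounded_bilinear.tendsto[OF bounded_bilinear_blinfun_compose] S)
  then have fixpoint: "S = (1/2) *\<^sub>R (U + (S o\<^sub>L S))"
    using LIMSEQ_unique LIMSEQ_Suc[OF S] by blast
  have "norm S \<le> 1"
    by (rule LIMSEQ_le_const2[OF tendsto_norm[OF S]])
      (use sqrt_iter_norm[OF U(2)] sqrt_majorant_bounds order_trans in blast)
  then have "op_positive (id_blinfun - S)"
    using hermitian_limit[OF sqrt_iter_hermitian[OF U(1)] S] by (rule op_positive_id_minus[rotated])
  moreover have "(id_blinfun - S) o\<^sub>L (id_blinfun - S) = T"
  proof (rule blinfun_eqI)
    fix x
    have "2 *\<^sub>R S x = x - T x + S (S x)"
      using arg_cong[OF fixpoint, of "\<lambda>V. 2 *\<^sub>R blinfun_apply V x"]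
      by (simp add: U_def blinfun.bilinear_simps)
    then show "((id_blinfun - S) o\<^sub>L (id_blinfun - S)) x = T x"
      by (simp add: blinfun.bilinear_simps scaleR_2 algebra_simps)
  qed
  moreover have "R o\<^sub>L (id_blinfun - S) = (id_blinfun - S) o\<^sub>L R" if R: "R o\<^sub>L T = T o\<^sub>L R" for R
  proof (rule blinfun_eqI)
    fix x
    have "R o\<^sub>L U = U o\<^sub>L R"
      using R by (simp add: U_def blinfun_commute_iff blinfun.bilinear_simps)
    then have *: "R (sqrt_iter U n x) = sqrt_iter U n (R x)" for n
      using sqrt_iter_commute[of R U n] by (metis blinfun_apply_blinfun_compose)
    have "(\<lambda>n. R (sqrt_iter U n x)) \<longlonglongrightarrow> R (S x)"
      by (intro tendsto_intros S)
    then have "R (S x) = S (R x)"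
      unfolding * using lim LIMSEQ_unique by blast
    then show "(R o\<^sub>L (id_blinfun - S)) x = ((id_blinfun - S) o\<^sub>L R) x"
      by (simp add: blinfun.bilinear_simps)
  qed
  ultimately show ?thesis by blast
qed

lemma exists_sqrt:
  fixes T :: "'h::chilbert_space \<Rightarrow>\<^sub>L 'h"
  assumes T: "op_positive T"
  shows "\<exists>S. op_positive S \<and> S o\<^sub>L S = T \<and> (\<forall>R. R o\<^sub>L T = T o\<^sub>L R \<longrightarrow> R o\<^sub>L S = S o\<^sub>L R)"
proof -
  define k where "k = norm T + 1"
  have k: "k > 0" by (simp add: k_def add_nonneg_pos)
  have "norm T \<le> k" by (simp add: k_def)
  then have "op_positive ((1/k) *\<^sub>R T)" "norm ((1/k) *\<^sub>R T) \<le> 1"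
    using k by (auto intro: op_positive_scaleR T)
  from exists_sqrt_contraction[OF this] obtain S
    where S: "op_positive S" "S o\<^sub>L S = (1/k) *\<^sub>R T"
      and comm: "\<And>R. R o\<^sub>L ((1/k) *\<^sub>R T) = ((1/k) *\<^sub>R T) o\<^sub>L R \<Longrightarrow> R o\<^sub>L S = S o\<^sub>L R"
    by blast
  have "(sqrt k *\<^sub>R S) o\<^sub>L (sqrt k *\<^sub>R S) = k *\<^sub>R (S o\<^sub>L S)"
    using k by (intro blinfun_eqI) (simp add: blinfun.bilinear_simps)
  then have "(sqrt k *\<^sub>R S) o\<^sub>L (sqrt k *\<^sub>R S) = T"
    using k S by simp
  moreover have "R o\<^sub>L (sqrt k *\<^sub>R S) = (sqrt k *\<^sub>R S) o\<^sub>L R" if "R o\<^sub>L T = T o\<^sub>L R" for R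
    using comm[of R] that by (simp add: blinfun_commute_iff blinfun.bilinear_simps)
  moreover have "op_positive (sqrt k *\<^sub>R S)"
    using k S by (intro op_positive_scaleR) simp_all
  ultimately show ?thesis by blast
qed

lemma op_positive_inner_eq_0:
  fixes T :: "'h::chilbert_space \<Rightarrow>\<^sub>L 'h"
  assumes T: "op_positive T" and x: "inner (T x) x = 0"
  shows "T x = 0"
proof -
  obtain S where S: "op_positive S" "S o\<^sub>L S = T"
    using exists_sqrt[OF T] by blast
  have "T x = S (S x)" for x using S by auto
  with x S show ?thesis
    by (simp add: inner_square op_positive_hermitian)
qed

text \<open>As \<open>R\<close> and \<open>S\<close> commute, \<open>(R + S)(R - S) = R\<^sup>2 - S\<^sup>2 = 0\<close>.  Hence both positive operators \<open>R\<close> and \<open>S\<close> vanish on the range of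
  \<open>R - S\<close>, and \<open>(R - S)\<^sup>2 = 0\<close>.\<close>

lemma sqrt_unique:
  fixes R S :: "'h::chilbert_space \<Rightarrow>\<^sub>L 'h"
  assumes "op_positive R" "op_positive S" and sq: "R o\<^sub>L R = S o\<^sub>L S"
    and comm: "R o\<^sub>L S = S o\<^sub>L R"
  shows "R = S"
proof (rule blinfun_eqI)
  fix x
  have h: "hermitian (R - S)"
    using assms by (intro hermitian_diff op_positive_hermitian)
  define y where "y = R x - S x"
  have "R y + S y = 0"
    using fun_cong[OF arg_cong[OF sq, of blinfun_apply], of x]
      fun_cong[OF arg_cong[OF comm, of blinfun_apply], of x]
    by (simp add: y_def blinfun.bilinear_simps)
  then have "inner (R y) y + inner (S y) y = 0"
    by (simp flip: inner_add_left)
  then have "inner (R y) y = 0" "inner (S y) y = 0"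
    using assms op_positive_inner[of R y] op_positive_inner[of S y] by linarith+
  then have "(R - S) y = 0"
    using assms by (simp add: op_positive_inner_eq_0 blinfun.bilinear_simps)
  then have "(norm ((R - S) x))\<^sup>2 = 0"
    using inner_square[OF h, of x] by (simp add: y_def blinfun.bilinear_simps)
  then show "R x = S x" by (simp add: blinfun.bilinear_simps)
qed

lemma op_sqrt_properties:
  fixes T :: "'h::chilbert_space \<Rightarrow>\<^sub>L 'h"
  assumes T: "op_positive T"
  shows op_positive_sqrt: "op_positive (op_sqrt T)"
    and op_sqrt_square: "op_sqrt T o\<^sub>L op_sqrt T = T"
    and op_sqrt_commute: "R o\<^sub>L T = T o\<^sub>L R \<Longrightarrow> R o\<^sub>L op_sqrt T = op_sqrt T o\<^sub>L R"
proof -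
  obtain S where S: "op_positive S" "S o\<^sub>L S = T"
    and comm: "\<And>R. R o\<^sub>L T = T o\<^sub>L R \<Longrightarrow> R o\<^sub>L S = S o\<^sub>L R"
    using exists_sqrt[OF T] by blast
  have "op_sqrt T = S"
    unfolding op_sqrt_def
  proof (rule the_equality)
    fix S' assume S': "op_positive S' \<and> S' o\<^sub>L S' = T"
    \<comment> \<open>any root commutes with its square \<open>T\<close>, and therefore with the constructed root \<open>S\<close>\<close>
    then have "S' (T x) = T (S' x)" for x
      by (metis blinfun_apply_blinfun_compose)
    then have "S' o\<^sub>L S = S o\<^sub>L S'"
      by (intro comm) (simp add: blinfun_commute_iff)
    then show "S' = S"
      using S' S by (metis sqrt_unique)
  qed (use S in simp)
  then show "op_positive (op_sqrt T)" "op_sqrt T o\<^sub>L op_sqrt T = T"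
    "R o\<^sub>L T = T o\<^sub>L R \<Longrightarrow> R o\<^sub>L op_sqrt T = op_sqrt T o\<^sub>L R"
    using S comm[of R] by simp_all
qed

lemma op_abs_square_hermitian: "hermitian T \<Longrightarrow> op_abs T o\<^sub>L op_abs T = T o\<^sub>L T"
  by (simp add: op_abs_def op_adj_hermitian op_sqrt_square op_positive_square)

section \<open>The trace on the positive part\<close>

context von_neumann_algebra
begin

lemma memI: "\<lbrakk>T \<in> bounded_ops; \<And>R. R \<in> commutant M \<Longrightarrow> T o\<^sub>L R = R o\<^sub>L T\<rbrakk> \<Longrightarrow> T \<in> M"
  using bicommutant by (auto simp: commutant_def)

lemma mem_commute: "\<lbrakk>T \<in> M; R \<in> commutant M\<rbrakk> \<Longrightarrow> T o\<^sub>L R = R o\<^sub>L T"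
  by (simp add: commutant_def)

lemma mem_bounded: "T \<in> M \<Longrightarrow> T \<in> bounded_ops"
  using bounded by blast

lemma id_mem: "id_blinfun \<in> M"
  by (rule memI) (simp_all add: bounded_ops_id blinfun_commute_iff)

lemma add_mem: "\<lbrakk>S \<in> M; T \<in> M\<rbrakk> \<Longrightarrow> S + T \<in> M"
  by (rule memI) (use mem_commute[of S] mem_commute[of T] in
    \<open>simp_all add: bounded_ops_add mem_bounded blinfun_commute_iff blinfun.bilinear_simps\<close>)

lemma scaleR_mem: "T \<in> M \<Longrightarrow> r *\<^sub>R T \<in> M"
  by (rule memI) (use mem_commute[of T] in
    \<open>simp_all add: bounded_ops_scaleR mem_bounded blinfun_commute_iff blinfun.bilinear_simps\<close>)

lemma compose_mem: "\<lbrakk>S \<in> M; T \<in> M\<rbrakk> \<Longrightarrow> S o\<^sub>L T \<in> M"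
  by (rule memI) (use mem_commute[of S] mem_commute[of T] in
    \<open>simp_all add: bounded_ops_compose mem_bounded blinfun_commute_iff\<close>)

lemma diff_mem: "\<lbrakk>S \<in> M; T \<in> M\<rbrakk> \<Longrightarrow> S - T \<in> M"
  using add_mem[OF _ scaleR_mem[of T "-1"]] by simp

lemma op_sqrt_mem: "\<lbrakk>T \<in> M; op_positive T\<rbrakk> \<Longrightarrow> op_sqrt T \<in> M"
  by (rule memI)
    (simp add: hermitian_bounded op_positive_hermitian op_positive_sqrt,
      metis op_sqrt_commute mem_commute)

lemma square_pos_part: "\<lbrakk>T \<in> M; hermitian T\<rbrakk> \<Longrightarrow> T o\<^sub>L T \<in> pos_part M"
  by (simp add: pos_part_def compose_mem op_positive_square)

lemma sandwich_pos_part: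
  "\<lbrakk>S \<in> M; hermitian S; T \<in> pos_part M\<rbrakk> \<Longrightarrow> S o\<^sub>L T o\<^sub>L S \<in> pos_part M"
  by (simp add: pos_part_def compose_mem op_positive_sandwich)

lemma add_pos_part: "\<lbrakk>S \<in> pos_part M; T \<in> pos_part M\<rbrakk> \<Longrightarrow> S + T \<in> pos_part M"
  by (simp add: pos_part_def add_mem op_positive_add)

lemma scaleR_pos_part: "\<lbrakk>0 \<le> r; T \<in> pos_part M\<rbrakk> \<Longrightarrow> r *\<^sub>R T \<in> pos_part M"
  by (simp add: pos_part_def scaleR_mem op_positive_scaleR)

end

context faithful_normal_semifinite_trace
begin

lemma trace_mono:
  assumes "S \<in> pos_part M" "T \<in> pos_part M" "op_le S T"
  shows "\<rho> S \<le> \<rho> T"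
proof -
  have "T - S \<in> pos_part M"
    using assms by (simp add: pos_part_def op_le_def diff_mem)
  with assms additive[of S "T - S"] show ?thesis
    by simp
qed

lemma trace_scaleR_finite:
  "\<lbrakk>0 \<le> r; T \<in> pos_part M; \<rho> T < \<infinity>\<rbrakk> \<Longrightarrow> \<rho> (r *\<^sub>R T) < \<infinity>"
  by (simp add: pos_homogeneous ennreal_mult_less_top)

lemma trace_sandwich_finite:
  assumes Q: "Q \<in> M" "hermitian Q" "\<rho> (Q o\<^sub>L Q) < \<infinity>" and G: "G \<in> pos_part M"
  shows "\<rho> (Q o\<^sub>L G o\<^sub>L Q) < \<infinity>"
proof -
  have "\<rho> (Q o\<^sub>L G o\<^sub>L Q) \<le> \<rho> (norm G *\<^sub>R (Q o\<^sub>L Q))"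
  proof (rule trace_mono)
    show "op_le (Q o\<^sub>L G o\<^sub>L Q) (norm G *\<^sub>R (Q o\<^sub>L Q))"
    proof (rule op_leI)
      fix x
      show "inner ((Q o\<^sub>L G o\<^sub>L Q) x) x \<le> inner ((norm G *\<^sub>R (Q o\<^sub>L Q)) x) x"
        using inner_le_norm_square[of G "Q x"] Q
        by (simp add: blinfun.bilinear_simps inner_square hermitian_inner[of Q _ x])
    qed (use Q G in \<open>auto simp: pos_part_def op_positive_hermitian
        intro!: hermitian_sandwich hermitian_scaleR hermitian_compose\<close>)
  qed (use Q G in \<open>auto intro!: sandwich_pos_part scaleR_pos_part square_pos_part\<close>)
  also have "\<dots> < \<infinity>"
    using Q by (intro trace_scaleR_finite square_pos_part) auto
  finally show ?thesis .
qed

lemma L2_ideal_hermitian: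
  "hermitian X \<Longrightarrow> X \<in> L2_ideal M \<rho> \<longleftrightarrow> X \<in> M \<and> \<rho> (X o\<^sub>L X) < \<infinity>"
  by (simp add: L2_ideal_def op_abs_square_hermitian)

lemma L2_norm_hermitian: "hermitian X \<Longrightarrow> L2_norm \<rho> X = sqrt (enn2real (\<rho> (X o\<^sub>L X)))"
  by (simp add: L2_norm_def op_abs_square_hermitian)

lemma parallelogram:
  assumes "X \<in> M" "hermitian X" "Y \<in> M" "hermitian Y"
  shows "\<rho> ((X + Y) o\<^sub>L (X + Y)) + \<rho> ((X - Y) o\<^sub>L (X - Y))
    = 2 * \<rho> (X o\<^sub>L X) + 2 * \<rho> (Y o\<^sub>L Y)"
proof -
  have "((X + Y) o\<^sub>L (X + Y)) + ((X - Y) o\<^sub>L (X - Y)) = 2 *\<^sub>R (X o\<^sub>L X) + 2 *\<^sub>R (Y o\<^sub>L Y)"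
    by (rule blinfun_eqI) (simp add: blinfun.bilinear_simps scaleR_2)
  from arg_cong[OF this, of \<rho>] assms show ?thesis
    by (simp add: additive pos_homogeneous square_pos_part scaleR_pos_part add_mem diff_mem
      hermitian_add hermitian_diff)
qed

lemma L2_hermitian_add_diff:
  assumes "hermitian X" "hermitian Y" "X \<in> L2_ideal M \<rho>" "Y \<in> L2_ideal M \<rho>"
  shows "X + Y \<in> L2_ideal M \<rho>" "X - Y \<in> L2_ideal M \<rho>"
proof -
  have "\<rho> ((X + Y) o\<^sub>L (X + Y)) + \<rho> ((X - Y) o\<^sub>L (X - Y)) < \<infinity>"
    using assms by (subst parallelogram) (auto simp: L2_ideal_hermitian ennreal_mult_less_top)
  then show "X + Y \<in> L2_ideal M \<rho>" "X - Y \<in> L2_ideal M \<rho>"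
    using assms by (auto simp: L2_ideal_hermitian hermitian_add hermitian_diff add_mem diff_mem)
qed

text \<open>With \<open>Y = Q\<^sup>2\<close> and \<open>T = Q + XQ\<close> one has
  \<open>T\<^sup>*T = Y + 2 QXQ + QX\<^sup>2Q\<close> and \<open>TT\<^sup>* = Y + (XY + YX) + XYX\<close>, so the trace identity
  \<open>\<rho>(T\<^sup>*T) = \<rho>(TT\<^sup>*)\<close> says that \<open>XY + YX\<close>, half of
  \<open>(X + Y)\<^sup>2 - (X - Y)\<^sup>2\<close>, has trace \<open>2 \<rho>(QXQ) \<ge> 0\<close>.  As \<open>XY + YX\<close> need not be
  positive, it is kept inside sums of positive operators until the finite terms \<open>\<rho>(Y)\<close> and
  \<open>\<rho>(XYX) = \<rho>(QX\<^sup>2Q)\<close> can be cancelled.\<close>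

lemma trace_square_diff_le_add:
  assumes X: "X \<in> M" "op_positive X" "\<rho> (X o\<^sub>L X) < \<infinity>"
    and Q: "Q \<in> M" "hermitian Q" "\<rho> (Q o\<^sub>L Q) < \<infinity>"
  shows "\<rho> ((X - (Q o\<^sub>L Q)) o\<^sub>L (X - (Q o\<^sub>L Q))) \<le> \<rho> ((X + (Q o\<^sub>L Q)) o\<^sub>L (X + (Q o\<^sub>L Q)))"
proof -
  define Y where "Y = Q o\<^sub>L Q"
  define T where "T = Q + (X o\<^sub>L Q)"
  define T' where "T' = Q + (Q o\<^sub>L X)"
  have Xh: "hermitian X" and Xp: "X \<in> pos_part M" and Y: "Y \<in> pos_part M" "Y \<in> M" "hermitian Y"
    using X Q by (auto simp: Y_def op_positive_hermitian square_pos_part compose_mem pos_part_def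
      op_positive_square)
  have b: "X \<in> bounded_ops" "Q \<in> bounded_ops" using X Q mem_bounded by auto
  have adj: "inner (T x) y = inner x (T' y)" for x y
    using Xh Q by (simp add: T_def T'_def blinfun.bilinear_simps inner_simps hermitian_inner)
  have bT: "T \<in> bounded_ops" "T' \<in> bounded_ops"
    using b by (auto simp: T_def T'_def intro!: bounded_ops_add bounded_ops_compose)
  have adjT: "op_adj T = T'"
    using bT adj by (intro op_adj_eqI)
  have adjXQ: "op_adj (X o\<^sub>L Q) = Q o\<^sub>L X"
    using Xh Q b by (intro op_adj_eqI bounded_ops_compose) (auto simp: hermitian_inner)
  have TM: "T \<in> M" "T' \<in> M" "X o\<^sub>L Q \<in> M"
    using X Q unfolding T_def T'_def by (blast intro: add_mem compose_mem)+
  have mem: "Q o\<^sub>L X o\<^sub>L Q \<in> pos_part M" "Q o\<^sub>L (X o\<^sub>L X) o\<^sub>L Q \<in> pos_part M"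
      "X o\<^sub>L Y o\<^sub>L X \<in> pos_part M"
    using X Q Xh Xp Y by (simp_all add: sandwich_pos_part square_pos_part)
  have sq: "(X + Y) o\<^sub>L (X + Y) \<in> pos_part M" "(X - Y) o\<^sub>L (X - Y) \<in> pos_part M"
    using X Xh Y by (simp_all add: square_pos_part add_mem diff_mem hermitian_add hermitian_diff)
  have TT'_mem: "T o\<^sub>L T' \<in> pos_part M"
    using TM bT adj by (simp add: pos_part_def compose_mem op_positive_compose_adjoint)
  have T'T: "T' o\<^sub>L T = Y + 2 *\<^sub>R (Q o\<^sub>L X o\<^sub>L Q) + (Q o\<^sub>L (X o\<^sub>L X) o\<^sub>L Q)"
    by (rule blinfun_eqI) (simp add: Y_def T_def T'_def blinfun.bilinear_simps scaleR_2)
  have TT': "((X + Y) o\<^sub>L (X + Y)) + (2 *\<^sub>R Y + 2 *\<^sub>R (X o\<^sub>L Y o\<^sub>L X))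
      = ((X - Y) o\<^sub>L (X - Y)) + 2 *\<^sub>R (T o\<^sub>L T')"
    by (rule blinfun_eqI) (simp add: Y_def T_def T'_def blinfun.bilinear_simps scaleR_2)
  have "\<rho> (T o\<^sub>L T') = \<rho> Y + 2 * \<rho> (Q o\<^sub>L X o\<^sub>L Q) + \<rho> (Q o\<^sub>L (X o\<^sub>L X) o\<^sub>L Q)"
    using tracial[OF TM(1)] mem Y
    by (simp add: adjT T'T additive pos_homogeneous add_pos_part scaleR_pos_part)
  moreover have "\<rho> (Q o\<^sub>L (X o\<^sub>L X) o\<^sub>L Q) = \<rho> (X o\<^sub>L Y o\<^sub>L X)"
  proof -
    have "(Q o\<^sub>L X) o\<^sub>L (X o\<^sub>L Q) = Q o\<^sub>L (X o\<^sub>L X) o\<^sub>L Q"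
      and "(X o\<^sub>L Q) o\<^sub>L (Q o\<^sub>L X) = X o\<^sub>L Y o\<^sub>L X"
      by (auto intro!: blinfun_eqI simp: Y_def)
    then show ?thesis
      using tracial[OF TM(3)] by (simp add: adjXQ)
  qed
  moreover have "\<rho> ((X + Y) o\<^sub>L (X + Y)) + (2 * \<rho> Y + 2 * \<rho> (X o\<^sub>L Y o\<^sub>L X))
      = \<rho> ((X - Y) o\<^sub>L (X - Y)) + 2 * \<rho> (T o\<^sub>L T')"
    using arg_cong[OF TT', of \<rho>] mem Y sq TT'_mem
    by (simp add: additive pos_homogeneous add_pos_part scaleR_pos_part)
  ultimately have "(2 * \<rho> Y + 2 * \<rho> (X o\<^sub>L Y o\<^sub>L X)) + \<rho> ((X + Y) o\<^sub>L (X + Y))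
      = (2 * \<rho> Y + 2 * \<rho> (X o\<^sub>L Y o\<^sub>L X))
        + (\<rho> ((X - Y) o\<^sub>L (X - Y)) + 4 * \<rho> (Q o\<^sub>L X o\<^sub>L Q))"
    by (simp add: distrib_left mult.assoc[symmetric] ac_simps)
  moreover have "2 * \<rho> Y + 2 * \<rho> (X o\<^sub>L Y o\<^sub>L X) < \<infinity>"
    using Q X Xh trace_sandwich_finite[of Q "X o\<^sub>L X"] \<open>\<rho> (Q o\<^sub>L _ o\<^sub>L Q) = _\<close>
    by (simp add: Y_def ennreal_mult_less_top square_pos_part)
  ultimately have "\<rho> ((X + Y) o\<^sub>L (X + Y)) = \<rho> ((X - Y) o\<^sub>L (X - Y)) + 4 * \<rho> (Q o\<^sub>L X o\<^sub>L Q)"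
    by (auto simp: ennreal_add_left_cancel)
  then show ?thesis
    by (simp add: Y_def[symmetric])
qed

end

section \<open>Approximation of positive elements by squares\<close>

primrec blinfun_power :: "('h::real_normed_vector \<Rightarrow>\<^sub>L 'h) \<Rightarrow> nat \<Rightarrow> ('h \<Rightarrow>\<^sub>L 'h)"
  where "blinfun_power V 0 = id_blinfun"
  | "blinfun_power V (Suc n) = V o\<^sub>L blinfun_power V n"

lemma blinfun_power_commute:
  "R o\<^sub>L V = V o\<^sub>L R \<Longrightarrow> R o\<^sub>L blinfun_power V n = blinfun_power V n o\<^sub>L R"
  by (induction n) (auto simp: blinfun_commute_iff)

lemma op_positive_blinfun_power:
  assumes V: "op_positive V"
  shows "op_positive (blinfun_power V n)"
proof (induction n rule: induct_nat_012)
  case 0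
  show ?case by (simp add: op_positive_iff hermitian_id)
next
  case 1
  have "V o\<^sub>L id_blinfun = V" by (rule blinfun_eqI) simp
  then show ?case using V by simp
next
  case (ge2 n)
  have "V o\<^sub>L blinfun_power V n o\<^sub>L V = blinfun_power V (Suc (Suc n))"
    using blinfun_power_commute[of V V n] by (intro blinfun_eqI) (simp add: blinfun_commute_iff)
  then show ?case
    using op_positive_sandwich[OF op_positive_hermitian[OF V] ge2(1)] by simp
qed

lemma (in von_neumann_algebra) blinfun_power_mem: "V \<in> M \<Longrightarrow> blinfun_power V n \<in> M"
  by (induction n) (auto intro: id_mem compose_mem)

lemma (in von_neumann_algebra) sum_pos_part:
  fixes n :: nat
  assumes "\<And>k. F k \<in> pos_part M"
  shows "(\<Sum>k<n. F k) \<in> pos_part M"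
proof (induction n)
  case 0
  have "0 *\<^sub>R F 0 \<in> pos_part M" using assms by (intro scaleR_pos_part) auto
  then show ?case by simp
qed (use assms in \<open>auto intro: add_pos_part\<close>)

text \<open>With \<open>V = 1 - Y\<close> and \<open>z\<^sub>n = V\<^sup>nx\<close>, the inequality \<open>Y\<^sup>2 \<le> 1 - V\<^sup>2\<close> bounds \<open>\<parallel>Yz\<^sub>n\<parallel>\<^sup>2\<close> by the
  increment \<open>\<parallel>z\<^sub>n\<parallel>\<^sup>2 - \<parallel>z\<^sub>n\<^sub>+\<^sub>1\<parallel>\<^sup>2\<close> of a decreasing convergent sequence.\<close>

lemma blinfun_power_tendsto_0:
  fixes Y :: "'h::chilbert_space \<Rightarrow>\<^sub>L 'h"
  assumes Y: "op_positive Y" "norm Y \<le> 1"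
  shows "(\<lambda>n. Y (blinfun_power (id_blinfun - Y) n x)) \<longlonglongrightarrow> 0"
proof -
  define z where "z n = blinfun_power (id_blinfun - Y) n x" for n
  have le: "(norm (Y (z n)))\<^sup>2 \<le> (norm (z n))\<^sup>2 - (norm (z (Suc n)))\<^sup>2" for n
    using norm_id_minus_square[OF Y, of "z n"] by (simp add: z_def blinfun.bilinear_simps)
  have "convergent (\<lambda>n. (norm (z n))\<^sup>2)"
  proof (rule Bseq_monoseq_convergent)
    have dec: "decseq (\<lambda>n. (norm (z n))\<^sup>2)"
    proof (rule decseq_SucI)
      fix n
      show "(norm (z (Suc n)))\<^sup>2 \<le> (norm (z n))\<^sup>2"
        using le[of n] zero_le_power2[of "norm (Y (z n))"] by linarith
    qed
    then show "monoseq (\<lambda>n. (norm (z n))\<^sup>2)" by (rule decseq_imp_monoseq)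
    show "Bseq (\<lambda>n. (norm (z n))\<^sup>2)"
      using decseqD[OF dec, of 0] by (intro BseqI'[of _ "(norm (z 0))\<^sup>2"]) auto
  qed
  then obtain l where l: "(\<lambda>n. (norm (z n))\<^sup>2) \<longlonglongrightarrow> l"
    by (auto simp: convergent_def)
  have "(\<lambda>n. (norm (z n))\<^sup>2 - (norm (z (Suc n)))\<^sup>2) \<longlonglongrightarrow> 0"
    using tendsto_diff[OF l LIMSEQ_Suc[OF l]] by simp
  then have "(\<lambda>n. (norm (Y (z n)))\<^sup>2) \<longlonglongrightarrow> 0"
    by (rule tendsto_sandwich[OF _ _ tendsto_const, rotated 2]) (use le in auto)
  then have "(\<lambda>n. norm (Y (z n))) \<longlonglongrightarrow> 0"
    using tendsto_real_sqrt by fastforce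
  then show ?thesis
    unfolding z_def by (rule tendsto_norm_zero_cancel)
qed

context faithful_normal_semifinite_trace
begin

text \<open>Scale so that \<open>0 \<le> Y/r \<le> 1\<close> and put \<open>V = 1 - Y/r\<close>.  The geometric sum
  \<open>G\<^sub>n = (1 + V + \<dots> + V\<^sup>n\<^sup>-\<^sup>1)/r\<close> satisfies \<open>YG\<^sub>n = 1 - V\<^sup>n\<close>, so \<open>YG\<^sub>nY = Y - YV\<^sup>n\<close> approximates \<open>Y\<close>;
  it is the square of \<open>Q\<^sub>n = YG\<^sub>n\<^sup>1\<^sup>/\<^sup>2\<close>, and its trace is at most \<open>\<parallel>G\<^sub>n\<parallel> \<rho>(Y\<^sup>2)\<close>, hence finite.  The error
  \<open>Z\<^sub>n = YV\<^sup>n\<close> has \<open>Z\<^sub>n\<^sup>2\<close> decreasing to \<open>0\<close> strongly, so that \<open>Y\<^sup>2 - Z\<^sub>n\<^sup>2\<close> increases to \<open>Y\<^sup>2\<close>, and normality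
  gives \<open>\<rho>(Z\<^sub>n\<^sup>2) \<rightarrow> 0\<close>.\<close>

lemma square_approximation:
  assumes Y: "Y \<in> L2_ideal M \<rho>" "op_positive Y"
  shows "\<exists>Q. (\<forall>n. Q n \<in> M \<and> hermitian (Q n) \<and> \<rho> (Q n o\<^sub>L Q n) < \<infinity>) \<and>
    (\<lambda>n. L2_norm \<rho> (Y - (Q n o\<^sub>L Q n))) \<longlonglongrightarrow> 0"
proof -
  \<comment> \<open>the summand \<open>1\<close> keeps \<open>r\<close> positive when \<open>Y = 0\<close>\<close>
  define r where "r = norm Y + 1"
  have r: "r > 0" by (simp add: r_def add_nonneg_pos)
  define B where "B = (1/r) *\<^sub>R Y"
  define V where "V = id_blinfun - B"
  define P where "P = blinfun_power V"
  define G where "G n = (1/r) *\<^sub>R (\<Sum>k<n. P k)" for n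
  define Q where "Q n = Y o\<^sub>L op_sqrt (G n)" for n
  define Z where "Z n = Y o\<^sub>L P n" for n
  have Yh: "hermitian Y" and YM: "Y \<in> M" and Yfin: "\<rho> (Y o\<^sub>L Y) < \<infinity>"
    using Y by (auto simp: op_positive_hermitian L2_ideal_hermitian)
  have "norm Y \<le> r" by (simp add: r_def)
  then have B: "op_positive B" "norm B \<le> 1"
    using r Y by (auto simp: B_def intro: op_positive_scaleR)
  have V: "op_positive V" "norm V \<le> 1" "V \<in> M"
    using B YM unfolding V_def
    by (auto simp: B_def op_positive_id_minus op_positive_hermitian norm_id_minus_le_one
      intro!: diff_mem id_mem scaleR_mem)
  have YV: "Y o\<^sub>L V = V o\<^sub>L Y"
    by (simp add: V_def B_def blinfun_commute_iff blinfun.bilinear_simps)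
  have YP: "Y o\<^sub>L P n = P n o\<^sub>L Y" for n
    using blinfun_power_commute[OF YV] by (simp add: P_def)
  then have YPx: "Y (P n x) = P n (Y x)" for n x
    by (simp add: blinfun_commute_iff)
  have P: "P n \<in> pos_part M" for n
    using V by (simp add: P_def pos_part_def blinfun_power_mem op_positive_blinfun_power)
  have G: "G n \<in> pos_part M" for n
    using P r unfolding G_def by (intro scaleR_pos_part sum_pos_part) auto
  have YG: "Y o\<^sub>L G n = G n o\<^sub>L Y" for n
    by (simp add: blinfun_commute_iff G_def blinfun.bilinear_simps blinfun.sum_left
      blinfun.sum_right YPx)
  have S: "op_positive (op_sqrt (G n))" "op_sqrt (G n) o\<^sub>L op_sqrt (G n) = G n"
      "Y o\<^sub>L op_sqrt (G n) = op_sqrt (G n) o\<^sub>L Y" "op_sqrt (G n) \<in> M" for n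
    using G[of n] op_sqrt_commute[OF _ YG[of n]]
    by (simp_all add: pos_part_def op_positive_sqrt op_sqrt_square op_sqrt_mem)
  have telescope: "Y (G n x) = x - P n x" for n x
  proof (induction n)
    case 0
    show ?case by (simp add: G_def P_def blinfun.bilinear_simps)
  next
    case (Suc n)
    have "Y (G (Suc n) x) = Y (G n x) + (1/r) *\<^sub>R Y (P n x)"
      by (simp add: G_def blinfun.bilinear_simps scaleR_add_right)
    also have "\<dots> = x - P (Suc n) x"
      by (simp add: Suc P_def V_def B_def blinfun.bilinear_simps)
    finally show ?case .
  qed
  have Qsq: "Q n o\<^sub>L Q n = Y o\<^sub>L G n o\<^sub>L Y" for n
  proof (rule blinfun_eqI)
    fix x
    have "op_sqrt (G n) (Y u) = Y (op_sqrt (G n) u)" "op_sqrt (G n) (op_sqrt (G n) u) = G n u" for u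
      using S(2,3)[of n] by (metis blinfun_apply_blinfun_compose)+
    moreover have "Y (G n u) = G n (Y u)" for u
      using YG by (simp add: blinfun_commute_iff)
    ultimately show "(Q n o\<^sub>L Q n) x = (Y o\<^sub>L G n o\<^sub>L Y) x"
      by (simp add: Q_def)
  qed
  have diff: "Y - (Q n o\<^sub>L Q n) = Z n" for n
    unfolding Qsq by (rule blinfun_eqI) (simp add: Z_def telescope blinfun.bilinear_simps YPx)
  have Q: "Q n \<in> M \<and> hermitian (Q n) \<and> \<rho> (Q n o\<^sub>L Q n) < \<infinity>" for n
    using trace_sandwich_finite[OF YM Yh Yfin G, of n] compose_mem[OF YM S(4)[of n]]
      hermitian_compose[OF Yh op_positive_hermitian[OF S(1)] S(3)]
    unfolding Qsq by (simp add: Q_def)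
  have Zh: "hermitian (Z n)" and ZM: "Z n \<in> M" for n
    using P[of n] Yh YM YP[of n]
    by (auto simp: Z_def pos_part_def op_positive_hermitian intro!: compose_mem hermitian_compose)
  have Z_norm: "norm (Z n x) = norm (P n (Y x))" for n x
    by (simp add: Z_def YPx)
  have Z_dec: "norm (Z (Suc n) x) \<le> norm (Z n x)" for n x
  proof -
    have "norm (V (P n (Y x))) \<le> norm V * norm (P n (Y x))" by (rule norm_blinfun)
    also have "\<dots> \<le> 1 * norm (P n (Y x))" using V by (intro mult_right_mono) auto
    finally show ?thesis by (simp add: Z_norm P_def)
  qed
  then have Z_mono: "norm (Z n x) \<le> norm (Z m x)" if "m \<le> n" for m n x
    using lift_Suc_antimono_le[of "\<lambda>n. norm (Z n x)"] that by blast
  have Z_lim: "(\<lambda>n. norm (Z n x)) \<longlonglongrightarrow> 0" for x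
  proof -
    have "(\<lambda>n. r *\<^sub>R B (P n x)) \<longlonglongrightarrow> r *\<^sub>R 0"
      unfolding P_def V_def by (intro tendsto_intros blinfun_power_tendsto_0 B)
    then have "(\<lambda>n. Z n x) \<longlonglongrightarrow> 0"
      using r by (simp add: Z_def B_def blinfun.bilinear_simps)
    then show ?thesis by (rule tendsto_norm_zero)
  qed
  define E where "E n = (Y o\<^sub>L Y) - (Z n o\<^sub>L Z n)" for n
  have E_inner: "inner (E n x) x = (norm (Y x))\<^sup>2 - (norm (Z n x))\<^sup>2" for n x
    using inner_square[OF Yh, of x] inner_square[OF Zh, of n x]
    by (simp add: E_def blinfun.bilinear_simps inner_simps)
  have "(norm (Z n x))\<^sup>2 \<le> (norm (Y x))\<^sup>2" for n x
    using Z_mono[of 0 n x] by (intro power_mono) (simp_all add: Z_def P_def)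
  moreover have Eh: "hermitian (E n)" for n
    using Yh Zh by (auto simp: E_def intro!: hermitian_diff hermitian_compose)
  ultimately have E: "E n \<in> pos_part M" for n
    using diff_mem[OF compose_mem[OF YM YM] compose_mem[OF ZM ZM], of n n]
    by (simp add: pos_part_def op_positive_iff E_inner flip: E_def)
  have E_mono: "op_le (E m) (E n)" if "m \<le> n" for m n
    using Z_mono[OF that] by (intro op_leI Eh) (simp add: E_inner)
  have YY: "Y o\<^sub>L Y \<in> pos_part M" "\<And>n. Z n o\<^sub>L Z n \<in> pos_part M"
    using Yh YM Zh ZM by (auto intro: square_pos_part)
  have YYh: "hermitian (Y o\<^sub>L Y)" using Yh by (simp add: hermitian_compose)
  have split: "\<rho> (Y o\<^sub>L Y) = \<rho> (E n) + \<rho> (Z n o\<^sub>L Z n)" for n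
    using additive[OF E YY(2), of n n] by (simp add: E_def)
  have "\<rho> (Y o\<^sub>L Y) = (SUP S\<in>range E. \<rho> S)"
  proof (rule normal)
    fix S S' assume "S \<in> range E" "S' \<in> range E"
    then obtain m n where "S = E m" "S' = E n" by blast
    then show "\<exists>S''\<in>range E. op_le S S'' \<and> op_le S' S''"
      using E_mono[of m "max m n"] E_mono[of n "max m n"] by auto
  next
    fix S assume "S \<in> range E"
    then show "op_le S (Y o\<^sub>L Y)"
      using YYh Eh by (auto simp: E_inner inner_square[OF Yh] intro!: op_leI)
  next
    fix U assume U: "U \<in> pos_part M" "\<And>S. S \<in> range E \<Longrightarrow> op_le S U"
    show "op_le (Y o\<^sub>L Y) U"
    proof (rule op_leI[OF YYh])
      show "hermitian U" using U by (simp add: pos_part_def op_positive_hermitian)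
      fix x
      have "(\<lambda>n. (norm (Y x))\<^sup>2 - (norm (Z n x))\<^sup>2) \<longlonglongrightarrow> (norm (Y x))\<^sup>2 - 0\<^sup>2"
        by (intro tendsto_intros Z_lim)
      moreover have "(norm (Y x))\<^sup>2 - (norm (Z n x))\<^sup>2 \<le> inner (U x) x" for n
        using op_le_inner[OF U(2), of "E n" x] by (simp add: E_inner)
      ultimately have "(norm (Y x))\<^sup>2 - 0\<^sup>2 \<le> inner (U x) x"
        by (intro LIMSEQ_le_const2) auto
      then show "inner ((Y o\<^sub>L Y) x) x \<le> inner (U x) x"
        by (simp add: inner_square[OF Yh])
    qed
  qed (use E YY in auto)
  moreover have "incseq (\<lambda>n. \<rho> (E n))"
    by (intro monoI trace_mono E E_mono)
  ultimately have "(\<lambda>n. \<rho> (E n)) \<longlonglongrightarrow> \<rho> (Y o\<^sub>L Y)"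
    using LIMSEQ_SUP[of "\<lambda>n. \<rho> (E n)"] by (simp add: image_image)
  then have "(\<lambda>n. enn2real (\<rho> (E n))) \<longlonglongrightarrow> enn2real (\<rho> (Y o\<^sub>L Y))"
    using Yfin by (intro tendsto_enn2real) auto
  then have "(\<lambda>n. enn2real (\<rho> (Y o\<^sub>L Y)) - enn2real (\<rho> (E n))) \<longlonglongrightarrow> 0"
    using tendsto_diff[OF tendsto_const, of _ "enn2real (\<rho> (Y o\<^sub>L Y))" sequentially
      "enn2real (\<rho> (Y o\<^sub>L Y))"] by fastforce
  moreover have "enn2real (\<rho> (Y o\<^sub>L Y)) - enn2real (\<rho> (E n)) = enn2real (\<rho> (Z n o\<^sub>L Z n))" for n
    using split[of n] Yfin by (simp add: enn2real_plus)
  ultimately have "(\<lambda>n. sqrt (enn2real (\<rho> (Z n o\<^sub>L Z n)))) \<longlonglongrightarrow> sqrt 0"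
    by (intro tendsto_real_sqrt) simp
  then have "(\<lambda>n. L2_norm \<rho> (Y - (Q n o\<^sub>L Q n))) \<longlonglongrightarrow> 0"
    by (simp add: diff L2_norm_hermitian[OF Zh])
  with Q show ?thesis by blast
qed

end

section \<open>The cone of positive elements\<close>

context noncommutative_L2
begin

lemma embed_hermitian_diff:
  assumes "hermitian Y" "X \<in> L2_ideal M \<rho>" "Y \<in> L2_ideal M \<rho>"
  shows "\<iota> (X - Y) = \<iota> X - \<iota> Y"
proof -
  have h: "hermitian (- Y)" using hermitian_scaleR[of Y "-1"] assms by simp
  have "(- Y) o\<^sub>L (- Y) = Y o\<^sub>L Y"
    by (rule blinfun_eqI) (simp add: blinfun.bilinear_simps)
  then have "- Y \<in> L2_ideal M \<rho>"
    using assms h scaleR_mem[of Y "-1"] by (simp add: L2_ideal_hermitian)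
  then have "\<iota> (X + - Y) = \<iota> X + \<iota> ((-1) *\<^sub>C Y)"
    using assms by (simp only: embed_add scaleC_minus_one)
  also have "\<iota> ((-1) *\<^sub>C Y) = - \<iota> Y"
    using embed_scaleC[OF assms(3), of "-1"] by (simp only: scaleC_minus_one)
  finally show ?thesis by simp
qed

lemma norm_embed_square_diff_le_add:
  assumes X: "X \<in> L2_ideal M \<rho>" "op_positive X"
    and Q: "Q \<in> M" "hermitian Q" "\<rho> (Q o\<^sub>L Q) < \<infinity>"
  shows "Q o\<^sub>L Q \<in> L2_ideal M \<rho>"
    and "norm (\<iota> X - \<iota> (Q o\<^sub>L Q)) \<le> norm (\<iota> X + \<iota> (Q o\<^sub>L Q))"
proof -
  have Xh: "hermitian X" using X by (simp add: op_positive_hermitian)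
  have Y: "hermitian (Q o\<^sub>L Q)" using Q by (simp add: hermitian_compose)
  have "(Q o\<^sub>L Q) o\<^sub>L (Q o\<^sub>L Q) = Q o\<^sub>L (Q o\<^sub>L Q) o\<^sub>L Q"
    by (rule blinfun_eqI) simp
  then show I: "Q o\<^sub>L Q \<in> L2_ideal M \<rho>"
    using Q Y trace_sandwich_finite[OF Q square_pos_part[OF Q(1,2)]]
    by (simp add: L2_ideal_hermitian compose_mem)
  note S = L2_hermitian_add_diff[OF Xh Y X(1) I]
  have "\<rho> ((X - (Q o\<^sub>L Q)) o\<^sub>L (X - (Q o\<^sub>L Q))) \<le> \<rho> ((X + (Q o\<^sub>L Q)) o\<^sub>L (X + (Q o\<^sub>L Q)))"
    using X Xh Q by (intro trace_square_diff_le_add) (auto simp: L2_ideal_hermitian)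
  moreover have "\<rho> ((X + (Q o\<^sub>L Q)) o\<^sub>L (X + (Q o\<^sub>L Q))) < \<infinity>"
    using S(1) Xh Y by (simp add: L2_ideal_hermitian hermitian_add)
  ultimately have "L2_norm \<rho> (X - (Q o\<^sub>L Q)) \<le> L2_norm \<rho> (X + (Q o\<^sub>L Q))"
    using Xh Y by (simp add: L2_norm_hermitian hermitian_add hermitian_diff enn2real_mono)
  then show "norm (\<iota> X - \<iota> (Q o\<^sub>L Q)) \<le> norm (\<iota> X + \<iota> (Q o\<^sub>L Q))"
    using S X I Y by (simp flip: embed_hermitian_diff embed_add embed_norm)
qed

lemma norm_embed_diff_le_add:
  assumes X: "X \<in> L2_ideal M \<rho>" "op_positive X" and Y: "Y \<in> L2_ideal M \<rho>" "op_positive Y"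
  shows "norm (\<iota> X - \<iota> Y) \<le> norm (\<iota> X + \<iota> Y)"
proof -
  obtain Q where Q: "\<And>n. Q n \<in> M" "\<And>n. hermitian (Q n)" "\<And>n. \<rho> (Q n o\<^sub>L Q n) < \<infinity>"
    and lim: "(\<lambda>n. L2_norm \<rho> (Y - (Q n o\<^sub>L Q n))) \<longlonglongrightarrow> 0"
    using square_approximation[OF Y] by blast
  define F where "F n = Q n o\<^sub>L Q n" for n
  have F: "F n \<in> L2_ideal M \<rho>" "norm (\<iota> X - \<iota> (F n)) \<le> norm (\<iota> X + \<iota> (F n))"
      "hermitian (F n)" for n
    using norm_embed_square_diff_le_add[OF X Q] Q(2) by (auto simp: F_def hermitian_compose)
  have "L2_norm \<rho> (Y - F n) = norm (\<iota> Y - \<iota> (F n))" for n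
    using L2_hermitian_add_diff(2)[OF _ F(3) Y(1) F(1)] Y F
    by (simp add: op_positive_hermitian flip: embed_hermitian_diff embed_norm)
  then have "(\<lambda>n. norm (\<iota> Y - \<iota> (F n))) \<longlonglongrightarrow> 0"
    using lim by (simp add: F_def)
  then have "(\<lambda>n. \<iota> Y - (\<iota> Y - \<iota> (F n))) \<longlonglongrightarrow> \<iota> Y - 0"
    by (intro tendsto_diff tendsto_const) (rule tendsto_norm_zero_cancel)
  then have "(\<lambda>n. \<iota> (F n)) \<longlonglongrightarrow> \<iota> Y" by simp
  then show ?thesis
    by (intro LIMSEQ_le[of "\<lambda>n. norm (\<iota> X - \<iota> (F n))" _ "\<lambda>n. norm (\<iota> X + \<iota> (F n))"])
      (auto intro!: tendsto_intros F)
qed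

lemma L2_positive_norm_diff_le_add:
  assumes "L2_positive M \<rho> \<iota> P" "L2_positive M \<rho> \<iota> R"
  shows "norm (P - R) \<le> norm (P + R)"
proof -
  obtain F G where F: "\<And>n::nat. F n \<in> \<iota> ` {X \<in> L2_ideal M \<rho>. op_positive X}" "F \<longlonglongrightarrow> P"
    and G: "\<And>n::nat. G n \<in> \<iota> ` {X \<in> L2_ideal M \<rho>. op_positive X}" "G \<longlonglongrightarrow> R"
    using assms unfolding L2_positive_def closure_sequential by blast
  have "norm (F n - G n) \<le> norm (F n + G n)" for n
    using F(1)[of n] G(1)[of n] by (auto intro: norm_embed_diff_le_add)
  then show ?thesis
    by (intro LIMSEQ_le[of "\<lambda>n. norm (F n - G n)" _ "\<lambda>n. norm (F n + G n)"])
      (auto intro!: tendsto_intros F G)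
qed

end

section \<open>The uncertainty relation\<close>

lemma sesquilinear_diff:
  fixes \<Phi> :: "'a::complex_vector \<Rightarrow> 'a \<Rightarrow> 'l::complex_vector"
  assumes "sesquilinear \<Phi>"
  shows "\<Phi> (a - b) d = \<Phi> a d - \<Phi> b d" "\<Phi> d (a - b) = \<Phi> d a - \<Phi> d b"
proof -
  have m: "a - b = a + (-1) *\<^sub>C b" by (simp add: scaleC_minus_one)
  have "\<Phi> (a + (-1) *\<^sub>C b) d = \<Phi> a d + (-1) *\<^sub>C \<Phi> b d"
    using assms by (simp only: sesquilinear_def)
  then show "\<Phi> (a - b) d = \<Phi> a d - \<Phi> b d"
    unfolding m by (simp add: scaleC_minus_one)
  have "\<Phi> d (a + (-1) *\<^sub>C b) = \<Phi> d a + cnj (-1) *\<^sub>C \<Phi> d b"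
    using assms by (simp only: sesquilinear_def)
  then show "\<Phi> d (a - b) = \<Phi> d a - \<Phi> d b"
    unfolding m by (simp add: scaleC_minus_one)
qed

text \<open>The difference \<open>\<Phi>(a, b) - \<Phi>(b, a)\<close> is twice the skew part of \<open>\<Phi>(a, b)\<close>, which is why positivity of
  \<open>\<Phi>\<close> at the two points \<open>ta + \<i>b\<close> and \<open>ta - \<i>b\<close> suffices.\<close>

lemma (in noncommutative_L2) norm_commutator_le:
  fixes \<Phi> :: "'a::complex_vector \<Rightarrow> 'a \<Rightarrow> 'l"
  assumes \<Phi>: "sesquilinear \<Phi>" and pos: "\<And>d. L2_positive M \<rho> \<iota> (\<Phi> d d)"
  shows "norm (\<Phi> a b - \<Phi> b a) \<le> 2 * (sqrt (norm (\<Phi> a a)) * sqrt (norm (\<Phi> b b)))"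
proof -
  define C where "C = \<Phi> a b - \<Phi> b a"
  have add: "\<Phi> (u + v) w = \<Phi> u w + \<Phi> v w" "\<Phi> w (u + v) = \<Phi> w u + \<Phi> w v"
    and scale: "\<Phi> (k *\<^sub>C u) w = k *\<^sub>C \<Phi> u w" "\<Phi> w (k *\<^sub>C u) = cnj k *\<^sub>C \<Phi> w u"
    for u v w k using \<Phi> by (auto simp: sesquilinear_def)
  have expand: "\<Phi> (complex_of_real t *\<^sub>C a + k *\<^sub>C b) (complex_of_real t *\<^sub>C a + k *\<^sub>C b)
      = t\<^sup>2 *\<^sub>R \<Phi> a a + \<Phi> b b - (complex_of_real t * k) *\<^sub>C C" if "cnj k = - k" "k * k = -1" for t k
  proof -
    have "\<Phi> (complex_of_real t *\<^sub>C a + k *\<^sub>C b) (complex_of_real t *\<^sub>C a + k *\<^sub>C b)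
      = (complex_of_real t * complex_of_real t) *\<^sub>C \<Phi> a a + (complex_of_real t * k) *\<^sub>C \<Phi> b a
        + ((- (complex_of_real t * k)) *\<^sub>C \<Phi> a b + (- (k * k)) *\<^sub>C \<Phi> b b)"
      unfolding add scale by (simp add: that(1) scaleC_add_right scaleC_scaleC ac_simps)
    also have "\<dots> = t\<^sup>2 *\<^sub>R \<Phi> a a + \<Phi> b b
        - ((complex_of_real t * k) *\<^sub>C \<Phi> a b - (complex_of_real t * k) *\<^sub>C \<Phi> b a)"
      by (simp add: that(2) scaleC_minus_left scaleC_one power2_eq_square scaleR_scaleC)
    also have "(complex_of_real t * k) *\<^sub>C \<Phi> a b - (complex_of_real t * k) *\<^sub>C \<Phi> b a
        = (complex_of_real t * k) *\<^sub>C C"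
      by (simp add: C_def scaleC_diff_right)
    finally show ?thesis .
  qed
  have bound: "t * norm C \<le> t\<^sup>2 * norm (\<Phi> a a) + norm (\<Phi> b b)" if "t > 0" for t :: real
  proof -
    define S where "S = t\<^sup>2 *\<^sub>R \<Phi> a a + \<Phi> b b"
    define D where "D = (complex_of_real t * \<i>) *\<^sub>C C"
    have "L2_positive M \<rho> \<iota> (S - D)" "L2_positive M \<rho> \<iota> (S + D)"
      using pos[of "complex_of_real t *\<^sub>C a + \<i> *\<^sub>C b"] expand[of \<i> t]
        pos[of "complex_of_real t *\<^sub>C a + (- \<i>) *\<^sub>C b"] expand[of "- \<i>" t]
      by (simp_all add: S_def D_def scaleC_minus_left)
    then have "norm ((S + D) - (S - D)) \<le> norm ((S + D) + (S - D))"
      by (intro L2_positive_norm_diff_le_add)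
    also have "(S + D) - (S - D) = 2 *\<^sub>R D" by (simp add: scaleR_2)
    also have "(S + D) + (S - D) = 2 *\<^sub>R S" by (simp add: scaleR_2)
    finally have "norm D \<le> norm S" by simp
    also have "norm D = t * norm C"
      using that by (simp add: D_def norm_scaleC norm_mult)
    also have "norm S \<le> t\<^sup>2 * norm (\<Phi> a a) + norm (\<Phi> b b)"
      unfolding S_def by (rule order_trans[OF norm_triangle_ineq]) simp
    finally show ?thesis .
  qed
  define u where "u = sqrt (norm (\<Phi> a a))"
  define v where "v = sqrt (norm (\<Phi> b b))"
  have uv: "u \<ge> 0" "v \<ge> 0" "norm (\<Phi> a a) = u\<^sup>2" "norm (\<Phi> b b) = v\<^sup>2"
    by (simp_all add: u_def v_def)
  \<comment> \<open>near-optimal choice \<open>t = (v + \<epsilon>)/(u + \<epsilon>)\<close>; the perturbation covers \<open>u = 0\<close> and \<open>v = 0\<close>\<close>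
  have approx: "norm C \<le> 2 * ((u + \<epsilon>) * (v + \<epsilon>))" if "\<epsilon> > 0" for \<epsilon>
  proof -
    define p where "p = u + \<epsilon>"
    define q where "q = v + \<epsilon>"
    have pq: "p > 0" "q > 0" "u \<le> p" "v \<le> q" using uv that by (auto simp: p_def q_def)
    have "u\<^sup>2 \<le> p\<^sup>2" "v\<^sup>2 \<le> q\<^sup>2" using pq uv by (auto intro: power_mono)
    have "(q / p) * norm C \<le> (q / p)\<^sup>2 * u\<^sup>2 + v\<^sup>2"
      using bound[of "q / p"] pq uv by simp
    also have "\<dots> \<le> (q / p)\<^sup>2 * p\<^sup>2 + q\<^sup>2"
      by (intro add_mono mult_left_mono) (fact | simp)+
    also have "\<dots> = (q / p) * (2 * (p * q))"
      using pq by (simp add: power2_eq_square)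
    finally show ?thesis
      unfolding p_def[symmetric] q_def[symmetric]
      by (rule mult_left_le_imp_le) (use pq in simp)
  qed
  have "(\<lambda>n. 2 * ((u + inverse (real (Suc n))) * (v + inverse (real (Suc n)))))
      \<longlonglongrightarrow> 2 * ((u + 0) * (v + 0))"
    by (intro tendsto_intros LIMSEQ_inverse_real_of_nat)
  then have "norm C \<le> 2 * ((u + 0) * (v + 0))"
    by (rule LIMSEQ_le_const) (use approx in \<open>auto simp del: of_nat_Suc\<close>)
  then show ?thesis by (simp add: C_def u_def v_def)
qed

theorem proposition3p6:
  fixes A0 :: "'a::complex_vector set"
    and mul :: "'a \<Rightarrow> 'a \<Rightarrow> 'a"
    and star :: "'a \<Rightarrow> 'a"
    and e a b c :: 'a
    and M :: "('h::chilbert_space \<Rightarrow>\<^sub>L 'h) set"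
    and \<rho> :: "('h \<Rightarrow>\<^sub>L 'h) \<Rightarrow> ennreal"
    and \<iota> :: "('h \<Rightarrow>\<^sub>L 'h) \<Rightarrow> 'l::cbanach"
    and \<Phi> :: "'a \<Rightarrow> 'a \<Rightarrow> 'l"
    and r s :: real
  assumes "unital_quasi_star_algebra A0 mul star e"
    and "von_neumann_algebra M"
    and "faithful_normal_semifinite_trace M \<rho>"
    and "noncommutative_L2 M \<rho> \<iota>"
    and "sesquilinear \<Phi>"
    and "\<forall>d. L2_positive M \<rho> \<iota> (\<Phi> d d)"
    and "invariant_map A0 mul star \<Phi>"
    and "a = star a" and "b = star b"
    and "is_commutator A0 mul star \<Phi> a b c"
  shows "uncertainty \<Phi> e a r * uncertainty \<Phi> e b s \<ge> 1 / 2 * gamma_map \<Phi> e c"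
proof -
  interpret unital_quasi_star_algebra A0 mul star e by fact
  interpret noncommutative_L2 M \<rho> \<iota> by fact
  define a' where "a' = a - complex_of_real r *\<^sub>C e"
  define b' where "b' = b - complex_of_real s *\<^sub>C e"
  have scale: "\<Phi> (k *\<^sub>C u) w = k *\<^sub>C \<Phi> u w" "\<Phi> w (k *\<^sub>C u) = cnj k *\<^sub>C \<Phi> w u" for u w k
    using \<open>sesquilinear \<Phi>\<close> by (auto simp: sesquilinear_def)
  have swap: "\<Phi> a e = \<Phi> e a" "\<Phi> b e = \<Phi> e b"
    using \<open>invariant_map A0 mul star \<Phi>\<close> unit_mem \<open>a = star a\<close> \<open>b = star b\<close>
    unfolding invariant_map_def by (metis mult_unit_right)+
  have "\<Phi> a b - \<Phi> b a = \<Phi> c e"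
    using \<open>is_commutator A0 mul star \<Phi> a b c\<close> unit_mem \<open>a = star a\<close> \<open>b = star b\<close>
    unfolding is_commutator_def by (metis mult_unit_right)
  \<comment> \<open>the terms linear in \<open>r\<close> and \<open>s\<close> cancel by \<open>swap\<close>\<close>
  then have "\<Phi> c e = \<Phi> a' b' - \<Phi> b' a'"
    by (simp add: a'_def b'_def sesquilinear_diff[OF \<open>sesquilinear \<Phi>\<close>] scale swap
      scaleC_diff_right scaleC_scaleC mult.commute[of "complex_of_real r"])
  then show ?thesis
    using norm_commutator_le[OF \<open>sesquilinear \<Phi>\<close>, of a' b'] assms(6)
    by (simp add: uncertainty_def gamma_map_def a'_def b'_def)
qed

end
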